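(* Let $\Omega\subset\mathbb{R}^2$ be a bounded strictly star-shaped domain, with center $\mathbf{x}_0$. Its Friedrichs constant satisfies the bound $$\Gamma(\Omega)\le M(\Omega).$$
   Context: A domain is a nonempty connected open set. $\Omega$ is strictly star-shaped if there is an open ball $B\subset\Omega$ such that every segment with one end in $B$ and the other in $\Omega$ is contained in $\Omega$; the center $\mathbf{x}_0$ of such a ball is taken as origin of polar coordinates $(r,\theta)$. With $\mathbb{T}=\mathbb{R}/2\pi\mathbb{Z}$, the boundary is parametrized as $\partial\Omega=\{\mathbf{x}_0+f(\theta)(\cos\theta,\sin\theta):\theta\in\mathbb{T}\}$ with $f:\mathbb{T}\to(0,\infty)$ Lipschitz continuous (a known fact), so $f'(\theta)$ exists for almost every $\theta$. Suprema over $\theta\in\mathbb{T}$ of expressions containing $f'(\theta)$ are over those $\theta$ where $f'$ exists. Normalization: $\Omega$ is dilated about $\mathbf{x}_0$ so that $\max_{\theta\in\mathbb{T}}f(\theta)=1$ (for a general $\Omega$, $M(\Omega)$ below is defined through the dilated domain; $\Gamma(\Omega)$ is invariant by dilation). Under this normalization define $$P(\alpha,\theta)=\frac{1}{\alpha f(\theta)^2}\bigg(1+\frac{f'(\theta)^2}{f(\theta)^2-\alpha f(\theta)^4}\bigg),\qquad M(\Omega)=\inf_{\alpha\in(0,1)}\ \sup_{\theta\in\mathbb{T}}P(\alpha,\theta).$$ $M(\Omega)$ depends on the choice of $\mathbf{x}_0$. Friedrichs constant: identify $\mathbb{R}^2$ with $\mathbb{C}$ and let $\mathfrak{F}_\circ(\Omega)$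 be the space of complex-valued holomorphic functions on $\Omega$ that are square integrable and of mean value zero on $\Omega$. $\Gamma(\Omega)\in[0,\infty]$ is the smallest constant $\Gamma$ such that $\|h\|_{L^2(\Omega)}^2\le\Gamma\,\|g\|_{L^2(\Omega)}^2$ for all $h+ig\in\mathfrak{F}_\circ(\Omega)$ with $h,g$ real-valued. *)

theory Defs
  imports "HOL-Complex_Analysis.Complex_Analysis"
begin

text \<open>The plane is identified with \<^typ>\<open>complex\<close>; a function on
  $\mathbb{R}/2\pi\mathbb{Z}$ is represented by a \<open>2\<pi>\<close>-periodic function on \<^typ>\<open>real\<close>.\<close>

definition domain_in_plane :: "complex set \<Rightarrow> bool" where
  "domain_in_plane \<Omega> \<longleftrightarrow> \<Omega> \<noteq> {} \<and> open \<Omega> \<and> connected \<Omega>"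

definition strictly_star_shaped_at :: "complex \<Rightarrow> complex set \<Rightarrow> bool" where
  "strictly_star_shaped_at x0 \<Omega> \<longleftrightarrow>
     (\<exists>\<rho>>0. ball x0 \<rho> \<subseteq> \<Omega> \<and> (\<forall>b\<in>ball x0 \<rho>. \<forall>x\<in>\<Omega>. closed_segment b x \<subseteq> \<Omega>))"

text \<open>The function \<open>f\<close> of the polar parametrization of the boundary. That the description
  determines it, and that it parametrizes the whole boundary, is shown in
  \<open>polar_radius_unique\<close> and \<open>frontier_eq_polar_radius\<close>.\<close>

definition polar_radius :: "complex \<Rightarrow> complex set \<Rightarrow> real \<Rightarrow> real" where
  "polar_radius x0 \<Omega> \<theta> = (THE r. r > 0 \<and> x0 + of_real r * cis \<theta> \<in> frontier \<Omega>)"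

text \<open>Dilation about \<open>x0\<close> after which the maximum of the polar radius is 1.\<close>

definition normalized_domain :: "complex \<Rightarrow> complex set \<Rightarrow> complex set" where
  "normalized_domain x0 \<Omega> =
     (\<lambda>z. x0 + (z - x0) / of_real (SUP \<theta>. polar_radius x0 \<Omega> \<theta>)) ` \<Omega>"

definition HP_P :: "(real \<Rightarrow> real) \<Rightarrow> real \<Rightarrow> real \<Rightarrow> real" where
  "HP_P f \<alpha> \<theta> =
     1 / (\<alpha> * f \<theta> ^ 2) * (1 + deriv f \<theta> ^ 2 / (f \<theta> ^ 2 - \<alpha> * f \<theta> ^ 4))"

definition HP_M :: "complex \<Rightarrow> complex set \<Rightarrow> ereal" where
  "HP_M x0 \<Omega> =
     (let f = polar_radius x0 (normalized_domain x0 \<Omega>) in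
      INF \<alpha>\<in>{0<..<1}. SUP \<theta>\<in>{\<theta>. f differentiable (at \<theta>)}. ereal (HP_P f \<alpha> \<theta>))"

definition friedrichs_space :: "complex set \<Rightarrow> (complex \<Rightarrow> complex) set" where
  "friedrichs_space \<Omega> =
     {F. F holomorphic_on \<Omega> \<and> set_integrable lborel \<Omega> (\<lambda>z. (cmod (F z))\<^sup>2) \<and>
         (LINT z:\<Omega>|lborel. F z) = 0}"

text \<open>The infimum of the empty set is \<open>\<infinity>\<close>.\<close>

definition friedrichs_constant :: "complex set \<Rightarrow> ereal" where
  "friedrichs_constant \<Omega> =
     Inf {ereal c | c. 0 \<le> c \<and>
       (\<forall>F\<in>friedrichs_space \<Omega>.
          (LINT z:\<Omega>|lborel. (Re (F z))\<^sup>2) \<le> c * (LINT z:\<Omega>|lborel. (Im (F z))\<^sup>2))}"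

lemma strictly_star_shaped_below_frontier:
  assumes "strictly_star_shaped_at x0 \<Omega>" and p: "x0 + of_real r * u \<in> frontier \<Omega>"
    and t: "0 \<le> t" "t < r"
  shows "x0 + of_real t * u \<in> \<Omega>"
proof -
  obtain \<rho> where \<rho>: "\<rho> > 0"
    and seg: "\<And>b x. b \<in> ball x0 \<rho> \<Longrightarrow> x \<in> \<Omega> \<Longrightarrow> closed_segment b x \<subseteq> \<Omega>"
    using assms(1) unfolding strictly_star_shaped_at_def by blast
  define p where "p = x0 + of_real r * u"
  define l where "l = t / r"
  have l: "0 \<le> l" "l < 1" and lr: "l * r = t" using t by (auto simp: l_def)
  have "p \<in> closure \<Omega>" using p by (simp add: frontier_def p_def)
  moreover have "\<rho> * (1 - l) > 0" using \<rho> l by simp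
  ultimately obtain y where y: "y \<in> \<Omega>" "dist y p < \<rho> * (1 - l)"
    using closure_approachable by blast
  define b where "b = x0 + of_real (l / (1 - l)) * (p - y)"
  have "dist x0 b = l / (1 - l) * dist y p"
    using l by (simp add: b_def dist_norm norm_mult norm_divide norm_minus_commute flip: of_real_diff)
  also have "\<dots> \<le> 1 / (1 - l) * dist y p"
    using l by (intro mult_right_mono divide_right_mono) auto
  also have "\<dots> < \<rho>" using y(2) l by (simp add: field_simps)
  finally have b: "b \<in> ball x0 \<rho>" by simp
  have "(1 - l) *\<^sub>R b + l *\<^sub>R y = (1 - l) *\<^sub>R x0 + ((1 - l) * (l / (1 - l))) *\<^sub>R (p - y) + l *\<^sub>R y"
    by (simp add: b_def scaleR_conv_of_real algebra_simps)
  also have "(1 - l) * (l / (1 - l)) = l" using l by simp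
  also have "(1 - l) *\<^sub>R x0 + l *\<^sub>R (p - y) + l *\<^sub>R y = x0 + of_real (l * r) * u"
    by (simp add: p_def scaleR_conv_of_real algebra_simps)
  finally have "x0 + of_real t * u = (1 - l) *\<^sub>R b + l *\<^sub>R y" by (simp add: lr)
  hence "x0 + of_real t * u \<in> closed_segment b y"
    using l unfolding in_segment by (intro exI[of _ l]) auto
  thus ?thesis using seg[OF b y(1)] by blast
qed

lemma polar_radius_unique:
  assumes "open \<Omega>" "bounded \<Omega>" "strictly_star_shaped_at x0 \<Omega>"
  shows "\<exists>!r. r > 0 \<and> x0 + of_real r * cis \<theta> \<in> frontier \<Omega>"
proof -
  have x0: "x0 \<in> interior \<Omega>"
    using assms(1,3) by (auto simp: strictly_star_shaped_at_def interior_open)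
  obtain d where d: "0 < d" "x0 + d *\<^sub>R cis \<theta> \<in> frontier \<Omega>"
    using ray_to_frontier[OF assms(2) x0, of "cis \<theta>"] by (metis cis_neq_zero)
  have no: False if "0 < r" "r < s" "x0 + of_real r * cis \<theta> \<in> frontier \<Omega>"
    "x0 + of_real s * cis \<theta> \<in> frontier \<Omega>" for r s
    using strictly_star_shaped_below_frontier[OF assms(3) that(4), of r] that assms(1)
    by (auto simp: frontier_def interior_open)
  show ?thesis
  proof (rule ex1I[of _ d])
    show "0 < d \<and> x0 + of_real d * cis \<theta> \<in> frontier \<Omega>"
      using d by (simp add: scaleR_conv_of_real)
    show "r = d" if "0 < r \<and> x0 + of_real r * cis \<theta> \<in> frontier \<Omega>" for r
      using no[of r d] no[of d r] that d by (cases r d rule: linorder_cases) (auto simp: scaleR_conv_of_real)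
  qed
qed

lemma frontier_eq_polar_radius:
  assumes "open \<Omega>" "bounded \<Omega>" "strictly_star_shaped_at x0 \<Omega>"
  shows "frontier \<Omega> = range (\<lambda>\<theta>. x0 + of_real (polar_radius x0 \<Omega> \<theta>) * cis \<theta>)"
proof (intro equalityI subsetI)
  fix z assume z: "z \<in> frontier \<Omega>"
  have "x0 \<in> \<Omega>" using assms(3) by (auto simp: strictly_star_shaped_at_def)
  hence "z \<noteq> x0" using z assms(1) by (auto simp: frontier_def interior_open)
  hence pos: "cmod (z - x0) > 0" by simp
  have eq: "x0 + of_real (cmod (z - x0)) * cis (Arg (z - x0)) = z"
    by (simp add: flip: rcis_def) (simp add: rcis_cmod_Arg)
  have "polar_radius x0 \<Omega> (Arg (z - x0)) = cmod (z - x0)"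
    unfolding polar_radius_def
    by (rule the1_equality[OF polar_radius_unique[OF assms]]) (use pos eq z in simp)
  thus "z \<in> range (\<lambda>\<theta>. x0 + of_real (polar_radius x0 \<Omega> \<theta>) * cis \<theta>)"
    using eq by (intro image_eqI[of _ _ "Arg (z - x0)"]) auto
next
  fix z assume "z \<in> range (\<lambda>\<theta>. x0 + of_real (polar_radius x0 \<Omega> \<theta>) * cis \<theta>)"
  then obtain \<theta> where "z = x0 + of_real (polar_radius x0 \<Omega> \<theta>) * cis \<theta>" by blast
  thus "z \<in> frontier \<Omega>"
    using theI'[OF polar_radius_unique[OF assms, of \<theta>]] by (simp add: polar_radius_def)
qed

end

theory Submission
  imports Defs
begin

text \<open>Let \<open>F = h + ig\<close> be holomorphic, normalized by \<open>h (x0) = 0\<close>; since \<open>h\<close> has mean zero, subtracting the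
  constant \<open>h (x0)\<close> only increases its norm. Cauchy's formula for \<open>F\<^sup>2\<close> on the curve \<open>r = t f(\<theta>)\<close>, with
  \<open>dz / (z - x0) = (f'/f + i) d\<theta>\<close>, has the imaginary part
  \<open>\<integral> (h\<^sup>2 - g\<^sup>2 + 2hg f'/f) d\<theta> = - 2\<pi> g(x0)\<^sup>2 \<le> 0\<close>. With \<open>f\<close> normalized by \<open>max f = 1\<close>, bound \<open>2hg f'/f\<close> by
  \<open>(1 - \<alpha>f\<^sup>2) h\<^sup>2 + (f'/f)\<^sup>2 g\<^sup>2 / (1 - \<alpha>f\<^sup>2)\<close> to get \<open>\<integral> f\<^sup>2 h\<^sup>2 d\<theta> \<le> sup P \<cdot> \<integral> f\<^sup>2 g\<^sup>2 d\<theta>\<close> for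
  every \<open>t\<close>. Since the area element is \<open>f\<^sup>2 t dt d\<theta>\<close>, integrating against \<open>t dt\<close> gives the claim.

  As \<open>f\<close> is merely Lipschitz, this rests on its differentiability almost everywhere, proved from the Vitali
  covering theorem, and on the fundamental theorem of calculus for Lipschitz functions. Cauchy's formula then
  follows from a primitive of \<open>(F\<^sup>2 - F\<^sup>2(x0)) / (z - x0)\<close>.\<close>

section \<open>Lipschitz functions of a real variable\<close>

context
  fixes F :: "real \<Rightarrow> real"
  assumes mono: "\<And>x y. x \<le> y \<Longrightarrow> F x \<le> F y" and cont: "continuous_on UNIV F"
begin

lemma emeasure_interval_measure_ball_le:
  assumes "r > 0"
  shows "emeasure (interval_measure F) (ball c r) \<le> ennreal (F (c + r) - F (c - r))"
proof -
  have "ball c r \<subseteq> {c - r..c + r}" by (auto simp: ball_def dist_real_def abs_le_iff)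
  hence "emeasure (interval_measure F) (ball c r) \<le> emeasure (interval_measure F) {c - r..c + r}"
    by (intro emeasure_mono) auto
  thus ?thesis using assms mono cont by (simp add: emeasure_interval_measure_Icc)
qed

lemma emeasure_interval_measure_cball:
  assumes "r > 0"
  shows "emeasure (interval_measure F) (cball c r) = ennreal (F (c + r) - F (c - r))"
  using assms mono cont by (simp add: cball_eq_atLeastAtMost emeasure_interval_measure_Icc)

text \<open>By Vitali's theorem, countably many disjoint closed intervals inside \<open>U\<close>
  with slope at least \<open>q\<close> cover almost all of \<open>E\<close>. The Stieltjes mass of
  each is at least \<open>q\<close> times its length, and these masses add up to at most that of
  \<open>U\<close>.\<close>

lemma emeasure_le_interval_measure_if_steep:
  assumes E: "E \<in> sets borel" and U: "open U" "E \<subseteq> U" and q: "q \<ge> 0"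
    and steep: "\<And>x d. x \<in> E \<Longrightarrow> d > 0 \<Longrightarrow> \<exists>u v. x - d < u \<and> u < x \<and> x < v \<and> v < x + d \<and> q * (v - u) \<le> F v - F u"
  shows "ennreal q * emeasure lborel E \<le> emeasure (interval_measure F) U"
proof -
  define K where "K = {i::real \<times> real. 0 < snd i \<and> cball (fst i) (snd i) \<subseteq> U \<and>
     q * (2 * snd i) \<le> F (fst i + snd i) - F (fst i - snd i)}"
  have cov: "\<exists>i. i \<in> K \<and> x \<in> cball (fst i) (snd i) \<and> snd i < d" if x: "x \<in> E" and d: "d > 0" for x d
  proof -
    obtain e where e: "e > 0" "ball x e \<subseteq> U" using U x open_contains_ball by blast
    \<comment> \<open>Vitali's theorem asks only that \<open>x\<close> lie in the ball, so the ball
      centred at the midpoint of \<open>u\<close> and \<open>v\<close> will do;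
      \<open>min d e\<close> makes it both short and contained in \<open>U\<close>.\<close>
    obtain u v where uv: "x - min d e < u" "u < x" "x < v" "v < x + min d e" "q * (v - u) \<le> F v - F u"
      using steep[OF x, of "min d e"] d e by auto
    have *: "cball ((u + v) / 2) ((v - u) / 2) = {u..v}"
      by (simp add: cball_eq_atLeastAtMost field_simps)
    have mid: "(u + v) / 2 + (v - u) / 2 = v" "(u + v) / 2 - (v - u) / 2 = u" "2 * ((v - u) / 2) = v - u"
      by (simp_all add: field_simps)
    have "{u..v} \<subseteq> ball x e" using uv by (auto simp: ball_eq_greaterThanLessThan)
    hence "((u + v) / 2, (v - u) / 2) \<in> K" using uv e(2)
      unfolding K_def mem_Collect_eq fst_conv snd_conv * mid by (intro conjI) simp_all
    thus ?thesis using uv * by (intro exI[of _ "((u + v) / 2, (v - u) / 2)"]) auto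
  qed
  obtain C where C: "countable C" "C \<subseteq> K"
     "pairwise (\<lambda>i j. disjnt (cball (fst i) (snd i)) (cball (fst j) (snd j))) C"
     "negligible (E - (\<Union>i \<in> C. cball (fst i) (snd i)))"
    by (rule Vitali_covering_theorem_cballs[of K snd E fst]) (use cov in \<open>auto simp: K_def\<close>)
  define V where "V = (\<Union>i \<in> C. cball (fst i) (snd i))"
  have V: "V \<in> sets borel" unfolding V_def using C(1) by (intro sets.countable_UN'') auto
  have disj: "disjoint_family_on (\<lambda>i. cball (fst i) (snd i)) C"
    using C(3) by (auto simp: pairwise_def disjoint_family_on_def disjnt_def)
  have "emeasure lborel (E - V) = 0"
    using C(4) E V by (simp add: V_def[symmetric] negligible_iff_emeasure0)
  hence "emeasure lborel E \<le> emeasure lborel V"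
    using E V emeasure_Diff_null_set[of "E - V" lborel E] emeasure_mono[of "E - (E - V)" V lborel]
    by (simp add: null_sets_def Diff_Diff_Int)
  also have "\<dots> = (\<integral>\<^sup>+i. emeasure lborel (cball (fst i) (snd i)) \<partial>count_space C)"
    unfolding V_def using C(1) disj by (intro emeasure_UN_countable) auto
  finally have "ennreal q * emeasure lborel E \<le> ennreal q * \<dots>" by (intro mult_left_mono) auto
  also have "\<dots> = (\<integral>\<^sup>+i. ennreal q * emeasure lborel (cball (fst i) (snd i)) \<partial>count_space C)"
    by (rule nn_integral_cmult[symmetric]) simp
  also have "\<dots> \<le> (\<integral>\<^sup>+i. emeasure (interval_measure F) (cball (fst i) (snd i)) \<partial>count_space C)"
  proof (intro nn_integral_mono)
    fix i assume "i \<in> space (count_space C)"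
    hence i: "i \<in> K" using C by auto
    hence "ennreal q * emeasure lborel (cball (fst i) (snd i)) = ennreal (q * (2 * snd i))"
      using q by (simp add: K_def cball_eq_atLeastAtMost ennreal_mult')
    thus "ennreal q * emeasure lborel (cball (fst i) (snd i)) \<le> emeasure (interval_measure F) (cball (fst i) (snd i))"
      using i by (simp add: K_def emeasure_interval_measure_cball ennreal_leI)
  qed
  also have "\<dots> = emeasure (interval_measure F) V"
    unfolding V_def using C(1) disj by (intro emeasure_UN_countable[symmetric]) auto
  also have "\<dots> \<le> emeasure (interval_measure F) U"
    using U C(2) by (intro emeasure_mono) (auto simp: V_def K_def)
  finally show ?thesis .
qed

text \<open>The same selection with open intervals, so that \<open>V\<close> is open and can take
  the place of \<open>U\<close> in \<open>emeasure_le_interval_measure_if_steep\<close>. The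
  estimate concerns the Stieltjes mass of \<open>V\<close>, not of \<open>E\<close>: the remainder
  \<open>E - V\<close> is null for Lebesgue measure only.\<close>

lemma interval_measure_le_emeasure_if_flat:
  assumes U: "open U" "E \<subseteq> U" and p: "p \<ge> 0"
    and flat: "\<And>x d. x \<in> E \<Longrightarrow> d > 0 \<Longrightarrow> \<exists>u v. x - d < u \<and> u < x \<and> x < v \<and> v < x + d \<and> F v - F u \<le> p * (v - u)"
  obtains V where "open V" "V \<subseteq> U" "negligible (E - V)"
    "emeasure (interval_measure F) V \<le> ennreal p * emeasure lborel U"
proof -
  define K where "K = {i::real \<times> real. 0 < snd i \<and> ball (fst i) (snd i) \<subseteq> U \<and>
     F (fst i + snd i) - F (fst i - snd i) \<le> p * (2 * snd i)}"
  have cov: "\<exists>i. i \<in> K \<and> x \<in> ball (fst i) (snd i) \<and> snd i < d" if x: "x \<in> E" and d: "d > 0" for x d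
  proof -
    obtain e where e: "e > 0" "ball x e \<subseteq> U" using U x open_contains_ball by blast
    obtain u v where uv: "x - min d e < u" "u < x" "x < v" "v < x + min d e" "F v - F u \<le> p * (v - u)"
      using flat[OF x, of "min d e"] d e by auto
    have *: "ball ((u + v) / 2) ((v - u) / 2) = {u<..<v}"
      by (simp add: ball_eq_greaterThanLessThan field_simps)
    have mid: "(u + v) / 2 + (v - u) / 2 = v" "(u + v) / 2 - (v - u) / 2 = u" "2 * ((v - u) / 2) = v - u"
      by (simp_all add: field_simps)
    have "{u<..<v} \<subseteq> ball x e" using uv by (auto simp: ball_eq_greaterThanLessThan)
    hence "((u + v) / 2, (v - u) / 2) \<in> K" using uv e(2)
      unfolding K_def mem_Collect_eq fst_conv snd_conv * mid by (intro conjI) simp_all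
    thus ?thesis using uv * by (intro exI[of _ "((u + v) / 2, (v - u) / 2)"]) auto
  qed
  obtain C where C: "countable C" "C \<subseteq> K"
     "pairwise (\<lambda>i j. disjnt (ball (fst i) (snd i)) (ball (fst j) (snd j))) C"
     "negligible (E - (\<Union>i \<in> C. ball (fst i) (snd i)))"
    by (rule Vitali_covering_theorem_balls[of E K fst snd]) (use cov in \<open>auto simp: K_def\<close>)
  define V where "V = (\<Union>i \<in> C. ball (fst i) (snd i))"
  have V: "open V" "V \<subseteq> U" using C(2) by (auto simp: V_def K_def)
  have disj: "disjoint_family_on (\<lambda>i. ball (fst i) (snd i)) C"
    using C(3) by (auto simp: pairwise_def disjoint_family_on_def disjnt_def)
  have "emeasure (interval_measure F) V = (\<integral>\<^sup>+i. emeasure (interval_measure F) (ball (fst i) (snd i)) \<partial>count_space C)"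
    unfolding V_def using C(1) disj by (intro emeasure_UN_countable) auto
  also have "\<dots> \<le> (\<integral>\<^sup>+i. ennreal p * emeasure lborel (ball (fst i) (snd i)) \<partial>count_space C)"
  proof (intro nn_integral_mono)
    fix i assume "i \<in> space (count_space C)"
    hence i: "i \<in> K" using C by auto
    hence "ennreal p * emeasure lborel (ball (fst i) (snd i)) = ennreal (p * (2 * snd i))"
      using p by (simp add: K_def ball_eq_greaterThanLessThan ennreal_mult')
    thus "emeasure (interval_measure F) (ball (fst i) (snd i)) \<le> ennreal p * emeasure lborel (ball (fst i) (snd i))"
      using i emeasure_interval_measure_ball_le[of "snd i" "fst i"] 
      by (auto simp: K_def intro: order_trans ennreal_leI)
  qed
  also have "\<dots> = ennreal p * (\<integral>\<^sup>+i. emeasure lborel (ball (fst i) (snd i)) \<partial>count_space C)"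
    by (rule nn_integral_cmult) simp
  also have "(\<integral>\<^sup>+i. emeasure lborel (ball (fst i) (snd i)) \<partial>count_space C) = emeasure lborel V"
    unfolding V_def using C(1) disj by (intro emeasure_UN_countable[symmetric]) auto
  also have "ennreal p * \<dots> \<le> ennreal p * emeasure lborel U"
    using V U by (intro mult_left_mono emeasure_mono) auto
  finally show ?thesis using that[of V] V C(4) by (simp add: V_def)
qed

text \<open>For a bounded part \<open>E\<close> of the set and an open \<open>U\<close> around it,
  the two preceding estimates chain through the Stieltjes mass of \<open>V\<close>: \<open>q\<close>
  times the Lebesgue measure of \<open>E\<close> is at most \<open>p\<close> times that of
  \<open>U\<close>. Letting \<open>U\<close> shrink to \<open>E\<close> forces measure zero, as
  \<open>p < q\<close>.\<close>

lemma negligible_flat_and_steep: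
  assumes p: "0 \<le> p" "p < q"
  shows "negligible {x. (\<forall>d>0. \<exists>u v. x - d < u \<and> u < x \<and> x < v \<and> v < x + d \<and> F v - F u < p * (v - u)) \<and>
    (\<forall>d>0. \<exists>u v. x - d < u \<and> u < x \<and> x < v \<and> v < x + d \<and> q * (v - u) < F v - F u)}"
    (is "negligible ?E")
proof -
  \<comment> \<open>For fixed \<open>d\<close>, the points \<open>x\<close> that suit given
    \<open>u\<close> and \<open>v\<close> form the open interval from \<open>max u (v - d)\<close>
    to \<open>min v (u + d)\<close>. Taking \<open>d = 1 / (n + 1)\<close> exhibits the set as a
    countable intersection of open sets, whatever \<open>P\<close> is.\<close>
  have gdelta: "{x. \<forall>d>0. \<exists>u v. x - d < u \<and> u < x \<and> x < v \<and> v < x + d \<and> P u v} \<in> sets borel"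
    for P :: "real \<Rightarrow> real \<Rightarrow> bool"
  proof -
    have "{x. \<forall>d>0. \<exists>u v. x - d < u \<and> u < x \<and> x < v \<and> v < x + d \<and> P u v} =
      (\<Inter>n. \<Union>{{max u (v - inverse (real (Suc n)))<..<min v (u + inverse (real (Suc n)))} | u v. P u v})"
      (is "?L = ?R")
    proof (intro equalityI subsetI)
      fix x assume x: "x \<in> ?L"
      show "x \<in> ?R"
      proof
        fix n
        have "inverse (real (Suc n)) > 0" by simp
        then obtain u v where "x - inverse (real (Suc n)) < u \<and> u < x \<and> x < v \<and> v < x + inverse (real (Suc n)) \<and> P u v"
          using x by blast
        thus "x \<in> \<Union>{{max u (v - inverse (real (Suc n)))<..<min v (u + inverse (real (Suc n)))} | u v. P u v}"
          by (intro UnionI[of "{max u (v - inverse (real (Suc n)))<..<min v (u + inverse (real (Suc n)))}"]) auto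
      qed
    next
      fix x assume x: "x \<in> ?R"
      have "\<exists>u v. x - d < u \<and> u < x \<and> x < v \<and> v < x + d \<and> P u v" if d: "d > 0" for d
      proof -
        obtain n where n: "inverse (real (Suc n)) < d" using reals_Archimedean[OF d] by blast
        obtain u v where "P u v" "x \<in> {max u (v - inverse (real (Suc n)))<..<min v (u + inverse (real (Suc n)))}"
          using x by blast
        thus ?thesis using n by (intro exI[of _ u] exI[of _ v]) auto
      qed
      thus "x \<in> ?L" by blast
    qed
    moreover have "?R \<in> sets borel"
      by (intro sets.countable_INT'') (auto intro!: borel_open open_Union)
    ultimately show ?thesis by simp
  qed
  have borelE: "?E \<in> sets borel"
  proof -
    have "?E = {x. \<forall>d>0. \<exists>u v. x - d < u \<and> u < x \<and> x < v \<and> v < x + d \<and> F v - F u < p * (v - u)} \<inter>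
       {x. \<forall>d>0. \<exists>u v. x - d < u \<and> u < x \<and> x < v \<and> v < x + d \<and> q * (v - u) < F v - F u}" by blast
    thus ?thesis using gdelta by auto
  qed
  \<comment> \<open>The cut-off gives \<open>E\<close> finite measure \<open>m\<close>, so that
    \<open>q * m \<le> p * m\<close> becomes an inequality between reals and yields
    \<open>m = 0\<close>.\<close>
  have "negligible (?E \<inter> cball 0 (real n))" for n
  proof -
    define E where "E = ?E \<inter> cball 0 (real n)"
    have E: "E \<in> sets borel" using borelE by (auto simp: E_def)
    have "E \<subseteq> {- real n..real n}" unfolding E_def cball_eq_atLeastAtMost by simp
    hence "emeasure lborel E \<le> emeasure lborel {- real n..real n}" by (rule emeasure_mono) simp
    hence fin: "emeasure lborel E < \<infinity>" by (rule order.strict_trans1) simp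
    have key: "ennreal q * emeasure lborel E \<le> ennreal p * emeasure lborel U" if U: "open U" "E \<subseteq> U" for U
    proof -
      obtain V where V: "open V" "V \<subseteq> U" "negligible (E - V)"
        "emeasure (interval_measure F) V \<le> ennreal p * emeasure lborel U"
      proof (rule interval_measure_le_emeasure_if_flat[OF U p(1)])
        show "\<exists>u v. x - d < u \<and> u < x \<and> x < v \<and> v < x + d \<and> F v - F u \<le> p * (v - u)"
          if "x \<in> E" "d > 0" for x d
        proof -
          note xd = that
          obtain u v where "x - d < u \<and> u < x \<and> x < v \<and> v < x + d \<and> F v - F u < p * (v - u)"
            using xd unfolding E_def by blast
          thus ?thesis using less_imp_le by blast
        qed
      qed
      have "E \<inter> V \<in> sets borel" using E V by auto
      hence 1: "ennreal q * emeasure lborel (E \<inter> V) \<le> emeasure (interval_measure F) V"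
      proof (rule emeasure_le_interval_measure_if_steep[OF _ V(1)])
        show "\<exists>u v. x - d < u \<and> u < x \<and> x < v \<and> v < x + d \<and> q * (v - u) \<le> F v - F u"
          if "x \<in> E \<inter> V" "d > 0" for x d
        proof -
          note xd = that
          obtain u v where "x - d < u \<and> u < x \<and> x < v \<and> v < x + d \<and> q * (v - u) < F v - F u"
            using xd unfolding E_def by blast
          thus ?thesis using less_imp_le by blast
        qed
      qed (use p in auto)
      have "emeasure lborel (E - V) = 0" using V E by (simp add: negligible_iff_emeasure0)
      hence "emeasure lborel E = emeasure lborel (E \<inter> V)"
        using E V by (subst emeasure_Diff_null_set[of "E - V", symmetric]) 
           (auto simp: null_sets_def Diff_Diff_Int)
      thus ?thesis using 1 V(4) by simp
    qed
    define m where "m = measure lborel E"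
    have m: "emeasure lborel E = ennreal m" using fin by (simp add: m_def emeasure_eq_ennreal_measure)
    have m0: "m \<ge> 0" by (simp add: m_def)
    have "q * m \<le> p * (m + e)" if e: "e > 0" for e
    proof -
      have "E \<in> sets lebesgue" using E by simp
      then obtain U where U: "open U" "E \<subseteq> U" "U - E \<in> lmeasurable" "emeasure lebesgue (U - E) < ennreal e"
        using sets_lebesgue_outer_open[OF _ e] by metis
      have "emeasure lborel U = emeasure lborel (E \<union> (U - E))" using U by (simp add: Un_absorb1)
      also have "\<dots> \<le> emeasure lborel E + emeasure lborel (U - E)"
        using U E by (intro emeasure_subadditive) auto
      also have "\<dots> \<le> ennreal m + ennreal e" using U E m by (intro add_mono) auto
      also have "\<dots> = ennreal (m + e)" using m0 e by simp
      finally have "ennreal q * ennreal m \<le> ennreal p * ennreal (m + e)"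
        using key[OF U(1,2)] m by (metis mult_left_mono order_trans zero_le)
      hence "ennreal (q * m) \<le> ennreal (p * (m + e))" using p m0 e by (simp add: ennreal_mult)
      thus ?thesis using p m0 e by (subst (asm) ennreal_le_iff) auto
    qed
    hence "eventually (\<lambda>e. q * m \<le> p * (m + e)) (at_right 0)"
      by (auto simp: eventually_at_right_field intro: exI[of _ 1])
    moreover have "((\<lambda>e. p * (m + e)) \<longlongrightarrow> p * (m + 0)) (at_right 0)"
      by (intro tendsto_intros)
    ultimately have "q * m \<le> p * m"
      using tendsto_lowerbound[of "\<lambda>e. p * (m + e)" "p * (m + 0)" "at_right 0" "q * m"] by simp
    hence "(q - p) * m \<le> 0" by (simp add: algebra_simps)
    hence "m = 0" using p m0 by (simp add: mult_le_0_iff)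
    thus "negligible (?E \<inter> cball 0 (real n))" using m E unfolding E_def[symmetric] by (simp add: negligible_iff_emeasure0)
  qed
  hence "negligible (\<Union>n. ?E \<inter> cball 0 (real n))" by (intro negligible_countable_Union) auto
  moreover have "?E \<subseteq> (\<Union>n. ?E \<inter> cball 0 (real n))"
  proof
    fix x assume "x \<in> ?E"
    moreover obtain n where "\<bar>x\<bar> \<le> real n" using real_arch_simple by blast
    ultimately show "x \<in> (\<Union>n. ?E \<inter> cball 0 (real n))" by auto
  qed
  ultimately show ?thesis using negligible_subset by blast
qed

end

section \<open>Differentiability almost everywhere\<close>

text \<open>Outside the union over rational \<open>p < q\<close> of the null sets from
  \<open>negligible_flat_and_steep\<close>, the quotients over short intervals straddling
  \<open>x\<close> have a limit, which the Lipschitz bound keeps finite. Letting one endpoint tend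
  to \<open>x\<close> turns it into the derivative.\<close>

lemma lipschitz_mono_differentiable_ae:
  fixes F :: "real \<Rightarrow> real"
  assumes mono: "\<And>x y. x \<le> y \<Longrightarrow> F x \<le> F y" and lip: "K-lipschitz_on UNIV F"
  shows "negligible {x. \<not> F differentiable at x}"
proof -
  have cont: "continuous_on UNIV F" using lip by (rule lipschitz_on_continuous_on)
  define flat where "flat x p \<longleftrightarrow> (\<forall>d>0. \<exists>u v. x - d < u \<and> u < x \<and> x < v \<and> v < x + d \<and> F v - F u < p * (v - u))" for x p
  define steep where "steep x q \<longleftrightarrow> (\<forall>d>0. \<exists>u v. x - d < u \<and> u < x \<and> x < v \<and> v < x + d \<and> q * (v - u) < F v - F u)" for x q
  have K: "K \<ge> 0" using lip lipschitz_on_nonneg by blast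
  have inc: "0 \<le> F v - F u" "F v - F u \<le> K * (v - u)" if "u < v" for u v
    using mono[of u v] lipschitz_onD[OF lip, of v u] that by (auto simp: dist_real_def)
  have not_flat: "\<not> flat x p" if "p \<le> 0" for x p
  proof
    assume "flat x p"
    then obtain u v where "u < v" "F v - F u < p * (v - u)" unfolding flat_def by (meson less_trans zero_less_one)
    thus False using inc(1)[of u v] that mult_nonpos_nonneg[of p "v - u"] by auto
  qed
  have flat: "flat x p" if "p > K" for x p
    unfolding flat_def
  proof (intro allI impI)
    fix d :: real assume d: "d > 0"
    have "F (x + d/2) - F (x - d/2) \<le> K * d" using inc(2)[of "x - d/2" "x + d/2"] d by simp
    also have "\<dots> < p * d" using that d by simp
    finally show "\<exists>u v. x - d < u \<and> u < x \<and> x < v \<and> v < x + d \<and> F v - F u < p * (v - u)"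
      using d by (intro exI[of _ "x - d/2"] exI[of _ "x + d/2"]) auto
  qed
  have diff: "F differentiable at x" if x: "\<And>p q. p \<in> \<rat> \<Longrightarrow> q \<in> \<rat> \<Longrightarrow> p < q \<Longrightarrow> \<not> (flat x p \<and> steep x q)" for x
  proof -
    \<comment> \<open>The lower limit of the straddling quotients. It is finite: the quotients lie
      between 0 and \<open>K\<close>, so \<open>flat x p\<close> fails for \<open>p \<le> 0\<close>
      and holds for \<open>p > K\<close>.\<close>
    define L where "L = Inf {p. flat x p}"
    have ne: "{p. flat x p} \<noteq> {}" using flat[of "K + 1"] by auto
    have bdd: "bdd_below {p. flat x p}" using not_flat by (intro bdd_belowI[of _ 0]) (auto simp: not_le intro: less_imp_le dest: leI)
    have approx: "\<exists>d>0. \<forall>y. 0 < \<bar>y - x\<bar> \<and> \<bar>y - x\<bar> < d \<longrightarrow> \<bar>(F y - F x) / (y - x) - L\<bar> \<le> e" if e: "e > 0" for e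
    proof -
      have "\<not> flat x (L - e)"
      proof
        assume "flat x (L - e)"
        hence "L \<le> L - e" unfolding L_def by (intro cInf_lower) (use bdd in auto)
        thus False using e by simp
      qed
      then obtain d1 where d1: "d1 > 0" "\<And>u v. x - d1 < u \<Longrightarrow> u < x \<Longrightarrow> x < v \<Longrightarrow> v < x + d1 \<Longrightarrow> (L - e) * (v - u) \<le> F v - F u"
        unfolding flat_def by (metis not_le)
      obtain p0 where p0: "flat x p0" "p0 < L + e"
        using cInf_lessD[OF ne, of "L + e"] e by (auto simp: L_def)
      \<comment> \<open>Two rationals are fitted between \<open>p0\<close> and \<open>L + e\<close>:
        \<open>flat x p\<close> is inherited from \<open>p0\<close>, so the assumption on
        \<open>x\<close> excludes \<open>steep x q\<close>, and this is the upper bound on the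
        quotients.\<close>
      obtain p where p: "p \<in> \<rat>" "p0 < p" "p < L + e" using Rats_dense_in_real[OF p0(2)] by blast
      obtain q where q: "q \<in> \<rat>" "p < q" "q < L + e" using Rats_dense_in_real[OF p(3)] by blast
      have "flat x p" unfolding flat_def
      proof (intro allI impI)
        fix d :: real assume "d > 0"
        then obtain u v where uv: "x - d < u" "u < x" "x < v" "v < x + d" "F v - F u < p0 * (v - u)"
          using p0(1) unfolding flat_def by blast
        moreover have "p0 * (v - u) \<le> p * (v - u)" using uv p by (intro mult_right_mono) auto
        ultimately have "F v - F u < p * (v - u)" by linarith
        thus "\<exists>u v. x - d < u \<and> u < x \<and> x < v \<and> v < x + d \<and> F v - F u < p * (v - u)"
          using uv by (intro exI[of _ u] exI[of _ v]) auto
      qed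
      hence "\<not> steep x q" using x[OF p(1) q(1,2)] by blast
      then obtain d2 where d2: "d2 > 0" "\<And>u v. x - d2 < u \<Longrightarrow> u < x \<Longrightarrow> x < v \<Longrightarrow> v < x + d2 \<Longrightarrow> F v - F u \<le> q * (v - u)"
        unfolding steep_def by (metis not_le)
      define d where "d = min d1 d2"
      have d: "d > 0" using d1 d2 by (simp add: d_def)
      have bound: "(L - e) * (v - u) \<le> F v - F u \<and> F v - F u \<le> (L + e) * (v - u)"
        if "x - d < u" "u < x" "x < v" "v < x + d" for u v
      proof -
        have "q * (v - u) \<le> (L + e) * (v - u)" using that q by (intro mult_right_mono) auto
        moreover have "(L - e) * (v - u) \<le> F v - F u" "F v - F u \<le> q * (v - u)"
          using d1(2)[of u v] d2(2)[of u v] that by (auto simp: d_def)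
        ultimately show ?thesis by linarith
      qed
      \<comment> \<open>Continuity allows one endpoint of a straddling interval to tend to
        \<open>x\<close>, which yields the same non-strict bounds for one-sided quotients.\<close>
      have cF: "(F \<longlongrightarrow> F x) (at x within S)" for S
        using cont by (metis UNIV_I continuous_on_def tendsto_within_subset subset_UNIV)
      have right: "(L - e) * (v - x) \<le> F v - F x \<and> F v - F x \<le> (L + e) * (v - x)" if v: "x < v" "v < x + d" for v
      proof
        have ev: "eventually (\<lambda>u. u \<in> {x - d<..<x}) (at_left x)" using d by (intro eventually_at_leftI[of "x - d"]) auto
        have l: "((\<lambda>u. F v - F u) \<longlongrightarrow> F v - F x) (at_left x)" by (intro tendsto_intros cF)
        have m: "((\<lambda>u. c * (v - u)) \<longlongrightarrow> c * (v - x)) (at_left x)" for c by (intro tendsto_intros)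
        show "(L - e) * (v - x) \<le> F v - F x"
          by (rule tendsto_le[OF _ l m]) (use ev v bound in \<open>auto elim!: eventually_mono\<close>)
        show "F v - F x \<le> (L + e) * (v - x)"
          by (rule tendsto_le[OF _ m l]) (use ev v bound in \<open>auto elim!: eventually_mono\<close>)
      qed
      have left: "(L - e) * (x - u) \<le> F x - F u \<and> F x - F u \<le> (L + e) * (x - u)" if u: "u < x" "x - d < u" for u
      proof
        have ev: "eventually (\<lambda>v. v \<in> {x<..<x + d}) (at_right x)" using d by (intro eventually_at_rightI[of _ "x + d"]) auto
        have l: "((\<lambda>v. F v - F u) \<longlongrightarrow> F x - F u) (at_right x)" by (intro tendsto_intros cF)
        have m: "((\<lambda>v. c * (v - u)) \<longlongrightarrow> c * (x - u)) (at_right x)" for c by (intro tendsto_intros)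
        show "(L - e) * (x - u) \<le> F x - F u"
          by (rule tendsto_le[OF _ l m]) (use ev u bound in \<open>auto elim!: eventually_mono\<close>)
        show "F x - F u \<le> (L + e) * (x - u)"
          by (rule tendsto_le[OF _ m l]) (use ev u bound in \<open>auto elim!: eventually_mono\<close>)
      qed
      have "\<bar>(F y - F x) / (y - x) - L\<bar> \<le> e" if y: "0 < \<bar>y - x\<bar>" "\<bar>y - x\<bar> < d" for y
      proof (cases "y > x")
        case True
        hence "L - e \<le> (F y - F x) / (y - x)" "(F y - F x) / (y - x) \<le> L + e"
          using right[of y] y by (auto simp: pos_le_divide_eq pos_divide_le_eq)
        thus ?thesis by linarith
      next
        case False
        hence "y < x" using y by auto
        hence "L - e \<le> (F x - F y) / (x - y)" "(F x - F y) / (x - y) \<le> L + e"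
          using left[of y] y by (auto simp: pos_le_divide_eq pos_divide_le_eq)
        moreover have "(F y - F x) / (y - x) = (F x - F y) / (x - y)" by (metis minus_diff_eq minus_divide_divide)
        ultimately show ?thesis by linarith
      qed
      thus ?thesis using d by blast
    qed
    have "((\<lambda>y. (F y - F x) / (y - x)) \<longlongrightarrow> L) (at x)"
      unfolding tendsto_iff eventually_at
    proof (intro allI impI)
      fix e :: real assume "e > 0"
      then obtain d where "d > 0" "\<forall>y. 0 < \<bar>y - x\<bar> \<and> \<bar>y - x\<bar> < d \<longrightarrow> \<bar>(F y - F x) / (y - x) - L\<bar> \<le> e / 2"
        using approx[of "e / 2"] by auto
      thus "\<exists>d>0. \<forall>y\<in>UNIV. y \<noteq> x \<and> dist y x < d \<longrightarrow> dist ((F y - F x) / (y - x)) L < e"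
        using \<open>e > 0\<close> by (intro exI[of _ d]) (fastforce simp: dist_real_def)
    qed
    hence "(F has_field_derivative L) (at x)" by (simp add: has_field_derivative_iff)
    thus ?thesis using real_differentiable_def by blast
  qed
  have "negligible {x. flat x p \<and> steep x q}" if "p < q" for p q
  proof (cases "p \<ge> 0")
    case True
    thus ?thesis using negligible_flat_and_steep[OF mono cont _ that] by (simp add: flat_def steep_def)
  next
    case False
    thus ?thesis using not_flat[of p] by simp
  qed
  moreover have "countable {(p::real, q). p \<in> \<rat> \<and> q \<in> \<rat> \<and> p < q}"
    by (rule countable_subset[of _ "\<rat> \<times> \<rat>"]) (auto simp: countable_rat)
  ultimately have "negligible (\<Union>i\<in>{(p, q). p \<in> \<rat> \<and> q \<in> \<rat> \<and> p < q}. {x. flat x (fst i) \<and> steep x (snd i)})"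
    by (intro negligible_countable_Union countable_image) auto
  thus ?thesis by (rule negligible_subset) (use diff in fastforce)
qed

text \<open>Adding \<open>K * x\<close> makes \<open>f\<close> nondecreasing and does not affect
  differentiability.\<close>

lemma lipschitz_differentiable_ae:
  fixes f :: "real \<Rightarrow> real"
  assumes lip: "K-lipschitz_on UNIV f"
  shows "negligible {x. \<not> f differentiable at x}"
proof -
  let ?F = "\<lambda>x. f x + K * x"
  have "?F x \<le> ?F y" if "x \<le> y" for x y
    using lipschitz_onD[OF lip, of x y] that by (auto simp: dist_real_def algebra_simps)
  moreover have "(K + K)-lipschitz_on UNIV ?F"
    using lipschitz_on_nonneg[OF lip]
    by (intro lipschitz_on_add[OF lip] lipschitz_onI) (auto simp: dist_real_def abs_mult simp flip: right_diff_distrib)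
  ultimately have "negligible {x. \<not> ?F differentiable at x}"
    by (rule lipschitz_mono_differentiable_ae)
  moreover have "f differentiable at x" if "?F differentiable at x" for x
  proof -
    have "(\<lambda>x. ?F x - K * x) differentiable at x" using that by (intro differentiable_diff) auto
    thus ?thesis by simp
  qed
  ultimately show ?thesis by (elim negligible_subset) blast
qed

text \<open>Dominated convergence for the difference quotients of \<open>W\<close>: they are bounded
  by \<open>K\<close> and tend to \<open>w\<close> off \<open>N\<close>. With an antiderivative
  \<open>I\<close> of \<open>W\<close>, their integrals are difference quotients of \<open>I\<close>
  at \<open>b\<close> minus those at \<open>a\<close>, which tend to
  \<open>W b - W a\<close>.\<close>

lemma has_integral_derivative_lipschitz:
  fixes W :: "real \<Rightarrow> 'a::euclidean_space"
  assumes lip: "K-lipschitz_on UNIV W" and N: "negligible N" and ab: "a \<le> b"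
    and deriv: "\<And>x. x \<notin> N \<Longrightarrow> (W has_vector_derivative w x) (at x)"
  shows "(w has_integral (W b - W a)) {a..b}"
proof -
  have cont: "continuous_on S W" for S
    using lipschitz_on_continuous_on[OF lip] continuous_on_subset by blast
  \<comment> \<open>The margins make \<open>I\<close> differentiable from both sides on
    \<open>{a..b + 1}\<close>, which contains \<open>x + h n\<close> for every \<open>x\<close> in
    \<open>{a..b}\<close> because \<open>h n \<le> 1\<close>.\<close>
  obtain I where I0: "\<And>x. x \<in> {a - 1..b + 2} \<Longrightarrow> (I has_vector_derivative W x) (at x within {a - 1..b + 2})"
    using antiderivative_continuous[OF cont] by blast
  have I: "(I has_vector_derivative W x) (at x)" if "a \<le> x" "x \<le> b + 1" for x
    using I0[of x] that by (simp add: at_within_Icc_at)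
  define h where "h n = inverse (real (Suc n))" for n
  have h: "h n > 0" "h n \<le> 1" for n by (auto simp: h_def field_simps)
  have hlim: "filterlim h (at 0) sequentially"
    using LIMSEQ_inverse_real_of_nat h(1) unfolding filterlim_at h_def[abs_def]
    by (auto simp: less_imp_neq[symmetric])
  have quot: "((\<lambda>n. (G (x + h n) - G x) /\<^sub>R h n) \<longlonglongrightarrow> g)" if "(G has_vector_derivative g) (at x)" for G :: "real \<Rightarrow> 'a" and x g
  proof -
    have "((\<lambda>t. (G (x + t) - G x) /\<^sub>R t) \<longlongrightarrow> g) (at 0)"
    proof (rule LIM_zero_cancel[OF tendsto_norm_zero_cancel])
      have "((\<lambda>t. norm (G (x + t) - G x - t *\<^sub>R g) / norm t) \<longlongrightarrow> 0) (at 0)"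
        using that by (simp add: has_vector_derivative_def has_derivative_at)
      moreover have "eventually (\<lambda>t. norm (G (x + t) - G x - t *\<^sub>R g) / norm t = norm ((G (x + t) - G x) /\<^sub>R t - g)) (at 0)"
      proof -
        have "norm (G (x + t) - G x - t *\<^sub>R g) / norm t = norm ((G (x + t) - G x) /\<^sub>R t - g)" if "t \<noteq> 0" for t
        proof -
          have "(G (x + t) - G x) /\<^sub>R t - g = (G (x + t) - G x - t *\<^sub>R g) /\<^sub>R t"
            using that by (simp add: scaleR_diff_right)
          thus ?thesis by (simp only: norm_scaleR norm_inverse real_norm_def) (simp add: divide_inverse_commute)
        qed
        thus ?thesis by (auto simp: eventually_at intro: exI[of _ 1])
      qed
      ultimately show "((\<lambda>t. norm ((G (x + t) - G x) /\<^sub>R t - g)) \<longlongrightarrow> 0) (at 0)"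
        by (rule Lim_transform_eventually)
    qed
    thus ?thesis using hlim by (rule filterlim_compose)
  qed
  \<comment> \<open>Dominated convergence is applied with convergence at every point, so quotients
    and limit are both set to 0 on \<open>N\<close>; this changes no integral.\<close>
  define D where "D n x = (if x \<in> N then 0 else (W (x + h n) - W x) /\<^sub>R h n)" for n x
  define w' where "w' x = (if x \<in> N then 0 else w x)" for x
  have "(w' has_integral (W b - W a)) {a..b}"
  proof (rule has_integral_dominated_convergence)
    show "(D n has_integral (((I (b + h n) - I b) /\<^sub>R h n) - ((I (a + h n) - I a) /\<^sub>R h n))) {a..b}" for n
    proof -
      have "((\<lambda>x. (W (x + h n) - W x) /\<^sub>R h n) has_integral ((I (b + h n) - I b) /\<^sub>R h n - (I (a + h n) - I a) /\<^sub>R h n)) {a..b}"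
      proof (rule fundamental_theorem_of_calculus[OF ab])
        fix x assume x: "x \<in> {a..b}"
        have "((\<lambda>x. I (x + h n)) has_vector_derivative (1::real) *\<^sub>R W (x + h n)) (at x)"
          by (rule vector_diff_chain_at[unfolded o_def, of "\<lambda>x. x + h n"])
             (use x h[of n] in \<open>auto intro!: derivative_eq_intros I\<close>)
        hence "((\<lambda>x. (I (x + h n) - I x) /\<^sub>R h n) has_vector_derivative (W (x + h n) - W x) /\<^sub>R h n) (at x)"
          using I[of x] x by (auto intro!: derivative_eq_intros simp: algebra_simps)
        thus "((\<lambda>x. (I (x + h n) - I x) /\<^sub>R h n) has_vector_derivative (W (x + h n) - W x) /\<^sub>R h n) (at x within {a..b})"
          by (rule has_vector_derivative_at_within)
      qed
      thus ?thesis by (rule has_integral_spike[OF N, rotated]) (auto simp: D_def)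
    qed
    show "(\<lambda>_. K) integrable_on {a..b}" by auto
    show "\<forall>x\<in>{a..b}. norm (D n x) \<le> K" for n
    proof
      fix x
      have "norm (W (x + h n) - W x) \<le> K * h n"
        using lipschitz_onD[OF lip, of "x + h n" x] h(1)[of n] by (simp add: dist_norm)
      hence "norm (W (x + h n) - W x) / h n \<le> K" using h(1)[of n] by (simp add: pos_divide_le_eq)
      thus "norm (D n x) \<le> K"
        using h(1)[of n] lipschitz_on_nonneg[OF lip] by (simp add: D_def divide_inverse_commute)
    qed
    show "\<forall>x\<in>{a..b}. (\<lambda>n. D n x) \<longlonglongrightarrow> w' x"
      using quot deriv by (auto simp: D_def w'_def)
    show "(\<lambda>n. (I (b + h n) - I b) /\<^sub>R h n - (I (a + h n) - I a) /\<^sub>R h n) \<longlonglongrightarrow> W b - W a"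
      using ab by (intro tendsto_diff quot I) auto
  qed
  thus ?thesis by (rule has_integral_spike[OF N, rotated]) (auto simp: w'_def)
qed

section \<open>Polar coordinates\<close>

text \<open>Vitali's theorem reduces the claim to balls: a rotation maps a ball to a ball of the
  same radius, and the null set left over to a null set.\<close>

lemma emeasure_rotation_open:
  fixes c :: complex
  assumes c: "cmod c = 1" and U: "open U"
  shows "emeasure lborel ((*) c ` U) = emeasure lborel U"
proof -
  define K where "K = {i::complex \<times> real. 0 < snd i \<and> ball (fst i) (snd i) \<subseteq> U}"
  have c0: "c \<noteq> 0" using c by auto
  obtain C where C: "countable C" "C \<subseteq> K"
     "pairwise (\<lambda>i j. disjnt (ball (fst i) (snd i)) (ball (fst j) (snd j))) C"
     "negligible (U - (\<Union>i \<in> C. ball (fst i) (snd i)))"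
  proof (rule Vitali_covering_theorem_balls[of U K fst snd])
    fix x d assume x: "x \<in> U" and d: "(d::real) > 0"
    obtain e where "e > 0" "ball x e \<subseteq> U" using U x open_contains_ball by blast
    thus "\<exists>i. i \<in> K \<and> x \<in> ball (fst i) (snd i) \<and> snd i < d"
      using d by (intro exI[of _ "(x, min e (d / 2))"]) (auto simp: K_def)
  qed auto
  define V where "V = (\<Union>i \<in> C. ball (fst i) (snd i))"
  have V: "open V" "V \<subseteq> U" using C(2) by (auto simp: V_def K_def)
  have cball: "(*) c ` ball a r = ball (c * a) r" for a r
  proof (intro equalityI subsetI)
    fix z assume "z \<in> ball (c * a) r"
    hence "z / c \<in> ball a r"
      using c c0 norm_mult[of c "a - z / c"] by (simp add: dist_norm right_diff_distrib)
    thus "z \<in> (*) c ` ball a r" using c0 by (intro image_eqI[of _ _ "z / c"]) auto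
  qed (use c in \<open>auto simp: dist_norm norm_mult simp flip: right_diff_distrib\<close>)
  have inj: "inj ((*) c)" using c0 by (auto simp: inj_on_def)
  have op: "open ((*) c ` S)" if "open S" for S
    using c0
    by (intro open_surjective_linear_image[OF that]) (auto intro!: bounded_linear.linear bounded_linear_mult_right surjI[of _ "\<lambda>z. z / c"])
  have disj: "disjoint_family_on (\<lambda>i. ball (fst i) (snd i)) C"
    using C(3) by (auto simp: pairwise_def disjoint_family_on_def disjnt_def)
  have disj': "disjoint_family_on (\<lambda>i. (*) c ` ball (fst i) (snd i)) C"
    using disj inj unfolding disjoint_family_on_def by (metis image_Int image_empty)
  have neg: "emeasure lborel (U - V) = 0" using C(4) U V by (simp add: V_def[symmetric] negligible_iff_emeasure0)
  have 1: "emeasure lborel U = emeasure lborel V"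
    using U V neg emeasure_Diff_null_set[of "U - V" lborel U] by (simp add: null_sets_def double_diff)
  have "negligible ((*) c ` (U - V))"
    using C(4) by (intro negligible_differentiable_image_negligible) (auto simp: V_def intro!: derivative_intros linear_imp_differentiable_on bounded_linear.linear bounded_linear_mult_right)
  hence neg': "emeasure lborel ((*) c ` U - (*) c ` V) = 0"
    using op[OF U] op[OF V(1)] by (simp add: image_set_diff[OF inj] negligible_iff_emeasure0)
  have "(*) c ` U - ((*) c ` U - (*) c ` V) = (*) c ` V" using V(2) by blast
  hence 2: "emeasure lborel ((*) c ` U) = emeasure lborel ((*) c ` V)"
    using op[OF U] op[OF V(1)] neg' emeasure_Diff_null_set[of "(*) c ` U - (*) c ` V" lborel "(*) c ` U"]
    by (simp add: null_sets_def)
  have "emeasure lborel ((*) c ` V) = (\<integral>\<^sup>+i. emeasure lborel ((*) c ` ball (fst i) (snd i)) \<partial>count_space C)"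
    unfolding V_def image_UN using C(1) disj' by (intro emeasure_UN_countable) (auto simp: cball)
  also have "\<dots> = (\<integral>\<^sup>+i. emeasure lborel (ball (fst i) (snd i)) \<partial>count_space C)"
    using C(2) by (intro nn_integral_cong) (auto simp: cball K_def emeasure_ball)
  also have "\<dots> = emeasure lborel V"
    unfolding V_def using C(1) disj by (intro emeasure_UN_countable[symmetric]) auto
  finally show ?thesis using 1 2 by simp
qed

lemma lborel_distr_rotation:
  fixes c :: complex
  assumes c: "cmod c = 1"
  shows "distr lborel borel ((*) c) = lborel"
proof (rule lborel_eqI[symmetric])
  fix l u :: complex assume le: "\<And>b. b \<in> Basis \<Longrightarrow> l \<bullet> b \<le> u \<bullet> b"
  have c0: "c \<noteq> 0" using c by auto
  have "(*) c -` box l u = (*) (1 / c) ` box l u"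
  proof (intro equalityI subsetI)
    fix z assume "z \<in> (*) c -` box l u"
    thus "z \<in> (*) (1 / c) ` box l u" using c0 by (intro image_eqI[of _ _ "c * z"]) auto
  qed (use c0 in auto)
  moreover have "emeasure lborel ((*) (1 / c) ` box l u) = emeasure lborel (box l u)"
    using c by (intro emeasure_rotation_open) (auto simp: norm_divide)
  moreover have "(*) c \<in> borel_measurable borel" by measurable
  ultimately show "emeasure (distr lborel borel ((*) c)) (box l u) = ennreal (\<Prod>b\<in>Basis. (u - l) \<bullet> b)"
    using le by (simp add: emeasure_distr emeasure_lborel_box_eq)
qed auto

text \<open>A disc has area \<open>pi * a^2\<close>, whose derivative is the density
  \<open>2 * pi * r\<close>; hence both measures agree on the half-lines, which generate the Borel
  sets.\<close>

lemma distr_norm_lborel_complex: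
  "distr lborel borel (norm :: complex \<Rightarrow> real) = density lborel (\<lambda>r. ennreal (2 * pi * r) * indicator {0..} r)"
  (is "?M = ?N")
proof (rule measure_eqI_generator_eq[where E = "range atMost" and \<Omega> = UNIV and A = "\<lambda>n. {..real n}"])
  show "Int_stable (range (atMost :: real \<Rightarrow> real set))" by (auto simp: Int_stable_def)
  have M: "emeasure ?M {..a} = ennreal (if a \<ge> 0 then pi * a\<^sup>2 else 0)" for a
  proof -
    have "norm -` {..a} = cball (0::complex) a" by auto
    thus ?thesis by (simp add: emeasure_distr emeasure_cball unit_ball_vol_2 mult.commute)
  qed
  have N: "emeasure ?N {..a} = ennreal (if a \<ge> 0 then pi * a\<^sup>2 else 0)" for a
  proof (cases "a \<ge> 0")
    case True
    have "emeasure ?N {..a} = (\<integral>\<^sup>+r. ennreal (2 * pi * r) * indicator {0..a} r \<partial>lborel)"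
      by (subst emeasure_density) (auto intro!: nn_integral_cong simp: indicator_def)
    also have "\<dots> = ennreal (pi * a\<^sup>2 - pi * 0\<^sup>2)"
      by (rule nn_integral_FTC_Icc) (use True in \<open>auto intro!: derivative_eq_intros\<close>)
    finally show ?thesis using True by simp
  next
    case False
    have "emeasure ?N {..a} = (\<integral>\<^sup>+r. ennreal (2 * pi * r) * indicator {0..} r * indicator {..a} r \<partial>lborel)"
      by (rule emeasure_density) auto
    also have "\<dots> = (\<integral>\<^sup>+r. 0 \<partial>(lborel::real measure))"
      using False by (intro nn_integral_cong) (auto simp: indicator_def)
    finally have "emeasure ?N {..a} = 0" by simp
    thus ?thesis using False by simp
  qed
  show "emeasure ?M X = emeasure ?N X" if "X \<in> range atMost" for X using that M N by auto
  show "emeasure ?M {..real n} \<noteq> \<infinity>" for n by (simp add: M)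
  show "(\<Union>n. {..real n}) = UNIV" by (auto simp: real_arch_simple)
qed (auto simp: borel_eq_atMost)

text \<open>The window is split at \<open>p - t\<close>: the part that the shift pushes beyond
  \<open>p\<close> is brought back by one period.\<close>

lemma nn_integral_periodic_shift:
  fixes g :: "real \<Rightarrow> ennreal"
  assumes [measurable]: "g \<in> borel_measurable borel" and per: "\<And>x. g (x + p) = g x" and t: "0 \<le> t" "t \<le> p"
  shows "(\<integral>\<^sup>+x. g (x + t) * indicator {0..<p} x \<partial>lborel) = (\<integral>\<^sup>+x. g x * indicator {0..<p} x \<partial>lborel)"
proof -
  have "(\<integral>\<^sup>+x. g (x + t) * indicator {0..<p} x \<partial>lborel) =
    (\<integral>\<^sup>+x. g (x + t) * indicator {0..<p - t} x + g (x + t) * indicator {p - t..<p} x \<partial>lborel)"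
    using t by (intro nn_integral_cong) (auto simp: indicator_def)
  also have "\<dots> = (\<integral>\<^sup>+x. g (x + t) * indicator {0..<p - t} x \<partial>lborel) + (\<integral>\<^sup>+x. g (x + t) * indicator {p - t..<p} x \<partial>lborel)"
    by (intro nn_integral_add) auto
  also have "(\<integral>\<^sup>+x. g (x + t) * indicator {0..<p - t} x \<partial>lborel) = (\<integral>\<^sup>+x. g x * indicator {t..<p} x \<partial>lborel)"
    by (subst nn_integral_real_affine[of "\<lambda>x. g x * indicator {t..<p} x" 1 t])
       (auto intro!: nn_integral_cong simp: indicator_def algebra_simps)
  also have "(\<integral>\<^sup>+x. g (x + t) * indicator {p - t..<p} x \<partial>lborel) = (\<integral>\<^sup>+x. g x * indicator {0..<t} x \<partial>lborel)"
  proof (subst nn_integral_real_affine[of "\<lambda>x. g x * indicator {0..<t} x" 1 "t - p"])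
    have "g (t - p + x) = g (x + t)" for x using per[of "t - p + x"] by (simp add: algebra_simps)
    thus "(\<integral>\<^sup>+x. g (x + t) * indicator {p - t..<p} x \<partial>lborel) =
       ennreal \<bar>1\<bar> * (\<integral>\<^sup>+x. g (t - p + 1 * x) * indicator {0..<t} (t - p + 1 * x) \<partial>lborel)"
      by (auto intro!: nn_integral_cong simp: indicator_def)
  qed auto
  also have "(\<integral>\<^sup>+x. g x * indicator {t..<p} x \<partial>lborel) + (\<integral>\<^sup>+x. g x * indicator {0..<t} x \<partial>lborel)
     = (\<integral>\<^sup>+x. g x * indicator {t..<p} x + g x * indicator {0..<t} x \<partial>lborel)"
    by (intro nn_integral_add[symmetric]) auto
  also have "\<dots> = (\<integral>\<^sup>+x. g x * indicator {0..<p} x \<partial>lborel)"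
    using t by (intro nn_integral_cong) (auto simp: indicator_def)
  finally show ?thesis .
qed

lemma borel_measurable_cis [measurable]: "cis \<in> borel_measurable borel"
  by (intro borel_measurable_continuous_onI) (auto intro!: continuous_intros)

text \<open>Averaging over rotations replaces a change of variables. By rotation invariance,
  \<open>2 * pi\<close> times the integral of \<open>\<phi>\<close> is the integral of the circular
  integral \<open>A\<close>; this depends only on \<open>cmod z\<close>, so the distribution of the
  norm finishes the computation.\<close>

lemma nn_integral_polar:
  fixes \<phi> :: "complex \<Rightarrow> ennreal"
  assumes [measurable]: "\<phi> \<in> borel_measurable borel"
  shows "(\<integral>\<^sup>+z. \<phi> z \<partial>lborel) =
    (\<integral>\<^sup>+r. ennreal r * indicator {0..} r * (\<integral>\<^sup>+\<theta>. \<phi> (of_real r * cis \<theta>) * indicator {0..<2*pi} \<theta> \<partial>lborel) \<partial>lborel)"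
proof -
  define A where "A z = (\<integral>\<^sup>+\<theta>. \<phi> (z * cis \<theta>) * indicator {0..<2*pi} \<theta> \<partial>lborel)" for z
  have A_meas [measurable]: "A \<in> borel_measurable borel" unfolding A_def by measurable
  have rot: "A z = A (of_real (cmod z))" for z
  proof -
    define t where "t = Arg2pi z"
    have t: "0 \<le> t" "t \<le> 2 * pi" "z = of_real (cmod z) * cis t"
      using Arg2pi_ge_0[of z] Arg2pi_lt_2pi[of z] Arg2pi_eq[of z] by (auto simp: t_def cis_conv_exp)
    have "A z = (\<integral>\<^sup>+\<theta>. \<phi> (of_real (cmod z) * cis (\<theta> + t)) * indicator {0..<2*pi} \<theta> \<partial>lborel)"
      unfolding A_def by (subst t(3)) (simp add: cis_mult mult.assoc add.commute)
    also have "\<dots> = (\<integral>\<^sup>+\<theta>. \<phi> (of_real (cmod z) * cis \<theta>) * indicator {0..<2*pi} \<theta> \<partial>lborel)"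
      by (rule nn_integral_periodic_shift[of "\<lambda>\<theta>. \<phi> (of_real (cmod z) * cis \<theta>)"]) (use t in \<open>auto simp flip: cis_mult\<close>)
    finally show ?thesis by (simp add: A_def)
  qed
  have "ennreal (2 * pi) * (\<integral>\<^sup>+z. \<phi> z \<partial>lborel) = (\<integral>\<^sup>+\<theta>. (\<integral>\<^sup>+z. \<phi> z \<partial>lborel) * indicator {0..<2*pi} (\<theta>::real) \<partial>lborel)"
    by (subst nn_integral_cmult) (auto simp: mult.commute)
  also have "\<dots> = (\<integral>\<^sup>+\<theta>. (\<integral>\<^sup>+z. \<phi> (z * cis \<theta>) * indicator {0..<2*pi} \<theta> \<partial>lborel) \<partial>lborel)"
  proof (intro nn_integral_cong)
    fix \<theta> :: real
    have "(\<integral>\<^sup>+z. \<phi> z \<partial>lborel) = (\<integral>\<^sup>+z. \<phi> z \<partial>distr lborel borel ((*) (cis \<theta>)))" by (simp add: lborel_distr_rotation)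
    also have "\<dots> = (\<integral>\<^sup>+z. \<phi> (z * cis \<theta>) \<partial>lborel)" by (subst nn_integral_distr) (auto simp: mult.commute)
    finally show "(\<integral>\<^sup>+z. \<phi> z \<partial>lborel) * indicator {0..<2*pi} \<theta> = (\<integral>\<^sup>+z. \<phi> (z * cis \<theta>) * indicator {0..<2*pi} \<theta> \<partial>lborel)"
      by (subst nn_integral_multc) auto
  qed
  also have "\<dots> = (\<integral>\<^sup>+z. A z \<partial>lborel)"
    unfolding A_def by (rule lborel_pair.Fubini') measurable
  also have "\<dots> = (\<integral>\<^sup>+z. A (of_real (cmod z)) \<partial>lborel)" using rot by (intro nn_integral_cong) auto
  also have "\<dots> = (\<integral>\<^sup>+r. A (of_real r) \<partial>distr lborel borel (norm :: complex \<Rightarrow> real))"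
    by (subst nn_integral_distr) auto
  also have "\<dots> = (\<integral>\<^sup>+r. ennreal (2 * pi * r) * indicator {0..} r * A (of_real r) \<partial>lborel)"
    by (simp add: distr_norm_lborel_complex nn_integral_density)
  also have "\<dots> = (\<integral>\<^sup>+r. ennreal (2 * pi) * (ennreal r * indicator {0..} r * A (of_real r)) \<partial>lborel)"
    by (intro nn_integral_cong) (auto simp: ennreal_mult mult_ac indicator_def)
  also have "\<dots> = ennreal (2 * pi) * (\<integral>\<^sup>+r. ennreal r * indicator {0..} r * A (of_real r) \<partial>lborel)"
    by (rule nn_integral_cmult) auto
  finally show ?thesis by (simp add: A_def ennreal_mult_cancel_left)
qed

section \<open>The polar radius\<close>

text \<open>A continuously differentiable map is locally Lipschitz, and compactness makes the
  constant uniform although \<open>S\<close> may fail to be convex.\<close>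

lemma holomorphic_lipschitz_on_compact:
  assumes hol: "Q holomorphic_on \<Omega>" and \<Omega>: "open \<Omega>" and S: "compact S" "S \<subseteq> \<Omega>"
  obtains L where "L-lipschitz_on S Q"
proof -
  \<comment> \<open>\<open>local_lipschitz\<close> speaks of maps with a time parameter; here the
    time is a dummy.\<close>
  have "local_lipschitz (UNIV :: real set) \<Omega> (\<lambda>_. Q)"
  proof (rule c1_implies_local_lipschitz[where f' = "\<lambda>p. blinfun_mult_right (deriv Q (snd p))"])
    show "(Q has_derivative blinfun_apply (blinfun_mult_right (deriv Q (snd (t, x))))) (at x)"
      if "x \<in> \<Omega>" for x and t :: real
      using holomorphic_derivI[OF hol \<Omega> that] by (simp add: has_field_derivative_def)
    show "continuous_on (UNIV \<times> \<Omega>) (\<lambda>p. blinfun_mult_right (deriv Q (snd p)))"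
      by (intro bounded_linear.continuous_on[OF bounded_linear_blinfun_mult_right]
           continuous_on_compose2[OF holomorphic_on_imp_continuous_on[OF holomorphic_deriv[OF hol \<Omega>]]] continuous_intros) auto
  qed (use \<Omega> in auto)
  hence "local_lipschitz {0::real} S (\<lambda>_. Q)" using S by (auto intro: local_lipschitz_subset)
  from local_lipschitz_compact_implies_lipschitz[OF this] S
  obtain L where "\<And>t::real. t \<in> {0} \<Longrightarrow> L-lipschitz_on S Q" by auto
  thus ?thesis using that by blast
qed

lemma norm_cis_diff_le: "norm (cis a - cis b) \<le> \<bar>a - b\<bar>"
proof -
  have "cis a - cis b = cis b * (cis (a - b) - 1)" by (simp add: right_diff_distrib cis_mult)
  also have "\<dots> = cis b * (exp (\<i> * of_real (a - b)) - 1)" by (simp only: cis_conv_exp)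
  finally have "cis a - cis b = cis b * (exp (\<i> * of_real (a - b)) - 1)" .
  hence "norm (cis a - cis b) = 2 * \<bar>sin ((a - b) / 2)\<bar>"
    using dist_exp_i_1[of "a - b"] by (simp only: norm_mult norm_cis)
  thus ?thesis using abs_sin_x_le_abs_x[of "(a - b) / 2"] by simp
qed

section \<open>Radial geometry of a bounded strictly star-shaped set\<close>

locale star_shaped_domain =
  fixes \<Omega> :: "complex set" and x0 :: complex
  assumes op: "open \<Omega>" and bdd: "bounded \<Omega>" and star: "strictly_star_shaped_at x0 \<Omega>"
begin

lemma polar_radius_pos: "polar_radius x0 \<Omega> \<theta> > 0"
  and polar_radius_frontier: "x0 + of_real (polar_radius x0 \<Omega> \<theta>) * cis \<theta> \<in> frontier \<Omega>"
  using theI'[OF polar_radius_unique[OF op bdd star, of \<theta>]] by (auto simp: polar_radius_def)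

lemma polar_radius_eqI:
  assumes "r > 0" "x0 + of_real r * cis \<theta> \<in> frontier \<Omega>"
  shows "polar_radius x0 \<Omega> \<theta> = r"
  unfolding polar_radius_def by (rule the1_equality[OF polar_radius_unique[OF op bdd star]]) (use assms in auto)

text \<open>One direction is \<open>strictly_star_shaped_below_frontier\<close>. Conversely, if
  \<open>r\<close> reached the polar radius, the frontier point on the ray would lie on a segment
  from \<open>x0\<close> to a point of \<Omega>, hence in \<Omega>, which is open and so disjoint
  from its frontier.\<close>

lemma mem_iff_less_polar_radius:
  assumes "r \<ge> 0"
  shows "x0 + of_real r * cis \<theta> \<in> \<Omega> \<longleftrightarrow> r < polar_radius x0 \<Omega> \<theta>"
proof
  assume "r < polar_radius x0 \<Omega> \<theta>"
  thus "x0 + of_real r * cis \<theta> \<in> \<Omega>"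
    using strictly_star_shaped_below_frontier[OF star polar_radius_frontier] assms by blast
next
  assume mem: "x0 + of_real r * cis \<theta> \<in> \<Omega>"
  show "r < polar_radius x0 \<Omega> \<theta>"
  proof (rule ccontr)
    assume "\<not> r < polar_radius x0 \<Omega> \<theta>"
    define l where "l = polar_radius x0 \<Omega> \<theta> / r"
    have r: "r > 0" "polar_radius x0 \<Omega> \<theta> = l * r" and l: "0 \<le> l" "l \<le> 1"
      using \<open>\<not> r < _\<close> polar_radius_pos[of \<theta>] by (auto simp: l_def)
    have "x0 + of_real (polar_radius x0 \<Omega> \<theta>) * cis \<theta> = (1 - l) *\<^sub>R x0 + l *\<^sub>R (x0 + of_real r * cis \<theta>)"
      by (simp add: r(2) scaleR_conv_of_real algebra_simps)
    hence "x0 + of_real (polar_radius x0 \<Omega> \<theta>) * cis \<theta> \<in> closed_segment x0 (x0 + of_real r * cis \<theta>)"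
      using l unfolding in_segment by blast
    hence "x0 + of_real (polar_radius x0 \<Omega> \<theta>) * cis \<theta> \<in> \<Omega>"
      using star mem unfolding strictly_star_shaped_at_def by (metis centre_in_ball subsetD)
    thus False using polar_radius_frontier[of \<theta>] op by (auto simp: frontier_def interior_open)
  qed
qed

lemma polar_radius_periodic: "polar_radius x0 \<Omega> (\<theta> + 2 * pi) = polar_radius x0 \<Omega> \<theta>"
  by (simp add: polar_radius_def flip: cis_mult)

lemma bdd_above_polar_radius: "bdd_above (range (polar_radius x0 \<Omega>))"
proof -
  obtain B where B: "\<And>z. z \<in> frontier \<Omega> \<Longrightarrow> dist x0 z \<le> B"
    using bounded_subset[OF bounded_closure[OF bdd], of "frontier \<Omega>"] bounded_any_center[of "frontier \<Omega>" x0]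
    by (auto simp: frontier_def)
  have "polar_radius x0 \<Omega> \<theta> \<le> B" for \<theta>
    using B[OF polar_radius_frontier[of \<theta>]] polar_radius_pos[of \<theta>] by (simp add: dist_norm norm_mult)
  thus ?thesis by (intro bdd_aboveI2)
qed

text \<open>On the unit circle, the inverse of the polar radius is the gauge \<open>p\<close> of \<open>\<Omega> - x0\<close>; star-shapedness
  with respect to the ball gives \<open>p (x + y) \<le> p x + \<bar>y\<bar> / \<rho>\<close>.\<close>

lemma inverse_polar_radius_le:
  assumes \<rho>: "\<rho> > 0" "ball x0 \<rho> \<subseteq> \<Omega>" "\<And>b x. b \<in> ball x0 \<rho> \<Longrightarrow> x \<in> \<Omega> \<Longrightarrow> closed_segment b x \<subseteq> \<Omega>"
  shows "1 / polar_radius x0 \<Omega> \<phi> \<le> 1 / polar_radius x0 \<Omega> \<theta> + \<bar>\<phi> - \<theta>\<bar> / \<rho>"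
proof (rule field_le_epsilon)
  fix e :: real assume e: "e > 0"
  define f where "f = polar_radius x0 \<Omega>"
  \<comment> \<open>\<open>k\<close> and \<open>\<sigma>\<close> exceed the gauge of
    \<open>cis \<theta>\<close> and the bound for the gauge of
    \<open>cis \<phi> - cis \<theta>\<close> by \<open>e / 2\<close> each, which puts
    \<open>x\<close> into \<Omega> and \<open>b\<close> into the ball. Weighted by \<open>k\<close>
    and \<open>\<sigma>\<close>, they combine to the point at distance
    \<open>1 / (k + \<sigma>)\<close> on the ray of angle \<open>\<phi>\<close>.\<close>
  define k where "k = 1 / f \<theta> + e / 2"
  define \<sigma> where "\<sigma> = \<bar>\<phi> - \<theta>\<bar> / \<rho> + e / 2"
  have f: "f \<psi> > 0" for \<psi> using polar_radius_pos by (simp add: f_def)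
  have k: "k > 0" "1 / k < f \<theta>" using f[of \<theta>] e by (auto simp: k_def field_simps add_pos_pos)
  have \<sigma>: "\<sigma> > 0" using e \<rho> by (simp add: \<sigma>_def add_nonneg_pos)
  define x where "x = x0 + of_real (1 / k) * cis \<theta>"
  define b where "b = x0 + of_real (1 / \<sigma>) * (cis \<phi> - cis \<theta>)"
  have x: "x \<in> \<Omega>" unfolding x_def using k by (subst mem_iff_less_polar_radius) (auto simp: f_def)
  have "dist x0 b = norm (cis \<phi> - cis \<theta>) / \<sigma>" using \<sigma> by (simp add: b_def dist_norm norm_divide)
  also have "\<dots> \<le> \<bar>\<phi> - \<theta>\<bar> / \<sigma>" using \<sigma> norm_cis_diff_le by (intro divide_right_mono) auto
  also have "\<dots> < \<rho>" using \<sigma> \<rho>(1) e by (simp add: \<sigma>_def field_simps add_pos_pos)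
  finally have b: "b \<in> ball x0 \<rho>" by simp
  define s where "s = k / (k + \<sigma>)"
  have s: "0 \<le> s" "s \<le> 1" using k \<sigma> by (auto simp: s_def)
  have s': "s * (1 / k) = 1 / (k + \<sigma>)" "(1 - s) * (1 / \<sigma>) = 1 / (k + \<sigma>)"
    using k \<sigma> by (auto simp: s_def field_simps)
  have "(1 - s) *\<^sub>R b + s *\<^sub>R x = x0 + of_real ((1 - s) * (1 / \<sigma>)) * (cis \<phi> - cis \<theta>) + of_real (s * (1 / k)) * cis \<theta>"
    unfolding b_def x_def scaleR_conv_of_real of_real_mult of_real_diff of_real_1 by algebra
  also have "\<dots> = x0 + of_real (1 / (k + \<sigma>)) * cis \<phi>" unfolding s' by (simp only: right_diff_distrib) simp
  finally have "x0 + of_real (1 / (k + \<sigma>)) * cis \<phi> \<in> closed_segment b x"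
    unfolding in_segment using s by (metis)
  hence "x0 + of_real (1 / (k + \<sigma>)) * cis \<phi> \<in> \<Omega>" using \<rho>(3)[OF b x] by blast
  hence "1 / (k + \<sigma>) < f \<phi>" using k \<sigma> by (subst (asm) mem_iff_less_polar_radius) (auto simp: f_def)
  hence "1 / f \<phi> < k + \<sigma>" using f[of \<phi>] k \<sigma> by (simp add: field_simps add_pos_pos)
  thus "1 / polar_radius x0 \<Omega> \<phi> \<le> 1 / polar_radius x0 \<Omega> \<theta> + \<bar>\<phi> - \<theta>\<bar> / \<rho> + e"
    by (simp add: k_def \<sigma>_def f_def)
qed

text \<open>The Lipschitz bound for \<open>1 / f\<close> passes to \<open>f\<close> through \<open>f
  \<theta> - f \<phi> = (1 / f \<phi> - 1 / f \<theta>) * (f \<theta> * f \<phi>)\<close>, since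
  \<open>f\<close> is bounded.\<close>

lemma polar_radius_lipschitz:
  obtains K where "K-lipschitz_on UNIV (polar_radius x0 \<Omega>)"
proof -
  obtain \<rho> where \<rho>: "\<rho> > 0" "ball x0 \<rho> \<subseteq> \<Omega>" "\<And>b x. b \<in> ball x0 \<rho> \<Longrightarrow> x \<in> \<Omega> \<Longrightarrow> closed_segment b x \<subseteq> \<Omega>"
    using star unfolding strictly_star_shaped_at_def by blast
  obtain m where m: "\<And>\<theta>. polar_radius x0 \<Omega> \<theta> \<le> m" using bdd_above_polar_radius by (auto simp: bdd_above_def)
  define f where "f = polar_radius x0 \<Omega>"
  have f: "f \<theta> > 0" "f \<theta> \<le> m" for \<theta> using polar_radius_pos m by (auto simp: f_def)
  have m0: "m > 0" using f[of 0] by linarith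
  have *: "f \<theta> - f \<phi> \<le> m * m / \<rho> * \<bar>\<phi> - \<theta>\<bar>" for \<theta> \<phi>
  proof -
    have "f \<theta> - f \<phi> = (1 / f \<phi> - 1 / f \<theta>) * (f \<theta> * f \<phi>)" using f(1)[of \<theta>] f(1)[of \<phi>] by (simp add: field_simps)
    also have "\<dots> \<le> (\<bar>\<phi> - \<theta>\<bar> / \<rho>) * (f \<theta> * f \<phi>)"
      using inverse_polar_radius_le[OF \<rho>, of \<phi> \<theta>] f(1)[of \<theta>] f(1)[of \<phi>] by (intro mult_right_mono) (auto simp: f_def)
    also have "\<dots> \<le> (\<bar>\<phi> - \<theta>\<bar> / \<rho>) * (m * m)"
      using f[of \<theta>] f[of \<phi>] m0 \<rho> by (intro mult_left_mono mult_mono) auto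
    finally show ?thesis by (simp add: mult_ac)
  qed
  have "(m * m / \<rho>)-lipschitz_on UNIV f"
  proof (rule lipschitz_onI)
    show "dist (f x) (f y) \<le> m * m / \<rho> * dist x y" for x y
      using *[of x y] *[of y x] by (auto simp: dist_real_def abs_minus_commute abs_le_iff)
  qed (use m0 \<rho> in auto)
  thus ?thesis using that by (simp add: f_def)
qed

lemma SUP_polar_radius: "(SUP \<theta>. polar_radius x0 \<Omega> \<theta>) > 0" "polar_radius x0 \<Omega> \<theta> \<le> (SUP \<theta>. polar_radius x0 \<Omega> \<theta>)"
proof -
  show *: "polar_radius x0 \<Omega> \<theta> \<le> (SUP \<theta>. polar_radius x0 \<Omega> \<theta>)" for \<theta>
    using bdd_above_polar_radius by (intro cSUP_upper) auto
  show "(SUP \<theta>. polar_radius x0 \<Omega> \<theta>) > 0" using polar_radius_pos[of 0] *[of 0] by linarith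
qed

text \<open>The dilation maps frontier onto frontier and rescales every ray from \<open>x0\<close>.
  The rest of the argument can therefore stay on \<Omega> itself, with \<open>f \<theta> / m\<close>
  as the normalized radius.\<close>

lemma polar_radius_normalized_domain:
  "polar_radius x0 (normalized_domain x0 \<Omega>) \<theta> = polar_radius x0 \<Omega> \<theta> / (SUP \<theta>. polar_radius x0 \<Omega> \<theta>)"
proof -
  define m where "m = (SUP \<theta>. polar_radius x0 \<Omega> \<theta>)"
  have m: "m > 0" using SUP_polar_radius by (simp add: m_def)
  define g where "g z = x0 + (z - x0) / of_real m" for z :: complex
  have "frontier (g ` \<Omega>) = g ` frontier \<Omega>"
  proof -
    have g: "g = (\<lambda>z. (x0 - x0 / of_real m) + z) \<circ> (*\<^sub>R) (1 / m)"
      using m by (auto simp: g_def fun_eq_iff scaleR_conv_of_real field_simps)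
    have "bij g" using m by (intro o_bij[of "\<lambda>z. x0 + (z - x0) * of_real m"]) (auto simp: g_def fun_eq_iff)
    moreover have "interior (g ` \<Omega>) = g ` interior \<Omega>"
      unfolding g image_comp[symmetric] using m
      by (subst interior_translation, subst interior_injective_linear_image) (auto simp: inj_on_def)
    moreover have "closure (g ` \<Omega>) = g ` closure \<Omega>"
      unfolding g image_comp[symmetric] by (simp add: closure_translation closure_scaleR)
    ultimately show ?thesis by (simp add: frontier_def image_set_diff bij_is_inj)
  qed
  hence fr: "z \<in> frontier (normalized_domain x0 \<Omega>) \<longleftrightarrow> z \<in> g ` frontier \<Omega>" for z
    by (simp add: normalized_domain_def g_def[abs_def] m_def)
  have "(x0 + of_real r * cis \<theta> \<in> frontier (normalized_domain x0 \<Omega>)) \<longleftrightarrow> x0 + of_real (r * m) * cis \<theta> \<in> frontier \<Omega>" for r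
  proof -
    have eq: "x0 + of_real r * cis \<theta> = g z \<longleftrightarrow> z = x0 + of_real (r * m) * cis \<theta>" for z
      using m by (auto simp: g_def field_simps)
    show ?thesis unfolding fr image_iff eq by blast
  qed
  hence "polar_radius x0 (normalized_domain x0 \<Omega>) \<theta> = (THE r. 0 < r \<and> x0 + of_real (r * m) * cis \<theta> \<in> frontier \<Omega>)"
    by (simp add: polar_radius_def)
  also have "\<dots> = polar_radius x0 \<Omega> \<theta> / m"
  proof (rule the_equality)
    show "0 < polar_radius x0 \<Omega> \<theta> / m \<and> x0 + of_real (polar_radius x0 \<Omega> \<theta> / m * m) * cis \<theta> \<in> frontier \<Omega>"
      using polar_radius_pos[of \<theta>] polar_radius_frontier[of \<theta>] m by simp
    show "r = polar_radius x0 \<Omega> \<theta> / m" if "0 < r \<and> x0 + of_real (r * m) * cis \<theta> \<in> frontier \<Omega>" for r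
      using polar_radius_eqI[of "r * m" \<theta>] that m by simp
  qed
  finally show ?thesis by (simp add: m_def)
qed

section \<open>Holomorphic functions on the dilated boundary curves\<close>

definition "f = polar_radius x0 \<Omega>"

definition "m = (SUP \<theta>. polar_radius x0 \<Omega> \<theta>)"

lemma f_pos: "f \<theta> > 0" and f_le_m: "f \<theta> \<le> m" and m_pos: "m > 0"
  using polar_radius_pos SUP_polar_radius by (auto simp: f_def m_def)

lemma curve_mem: "0 \<le> t \<Longrightarrow> t < 1 \<Longrightarrow> x0 + of_real (t * f \<theta>) * cis \<theta> \<in> \<Omega>"
  using f_pos[of \<theta>] by (subst mem_iff_less_polar_radius) (auto simp flip: f_def)

lemma f_lipschitz: obtains K where "K-lipschitz_on UNIV f"
  using polar_radius_lipschitz by (auto simp: f_def)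

lemma f_continuous: "continuous_on S f"
  using f_lipschitz lipschitz_on_continuous_on continuous_on_subset subset_UNIV by metis

lemma f_measurable [measurable]: "f \<in> borel_measurable borel"
  by (intro borel_measurable_continuous_onI f_continuous)

text \<open>Up to the constant \<open>ln t\<close>, this is the real part of a logarithm of
  \<open>z - x0\<close> along the dilated curves. It is Lipschitz because \<open>f\<close> is
  bounded below by the radius of a ball contained in \<Omega>.\<close>

lemma ln_f_lipschitz: obtains K where "K-lipschitz_on UNIV (\<lambda>\<theta>. ln (f \<theta>))"
proof -
  obtain \<rho> where \<rho>: "\<rho> > 0" "ball x0 \<rho> \<subseteq> \<Omega>" using star unfolding strictly_star_shaped_at_def by blast
  have f_ge: "\<rho> \<le> f \<theta>" for \<theta>
  proof (rule ccontr)
    assume "\<not> \<rho> \<le> f \<theta>"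
    hence "x0 + of_real (f \<theta>) * cis \<theta> \<in> ball x0 \<rho>" using f_pos[of \<theta>] by (simp add: dist_norm norm_mult)
    hence "f \<theta> < f \<theta>"
      using \<rho>(2) mem_iff_less_polar_radius[of "f \<theta>" \<theta>] f_pos[of \<theta>] by (auto simp flip: f_def)
    thus False by simp
  qed
  obtain K where K: "K-lipschitz_on UNIV f" by (rule f_lipschitz)
  have *: "ln (f x) - ln (f y) \<le> K / \<rho> * \<bar>x - y\<bar>" for x y
  proof -
    have "ln (f x) - ln (f y) \<le> (f x - f y) / f y" using f_pos by (intro ln_diff_le) auto
    also have "\<dots> \<le> \<bar>f x - f y\<bar> / f y" using f_pos[of y] by (intro divide_right_mono) auto
    also have "\<dots> \<le> \<bar>f x - f y\<bar> / \<rho>" using f_ge[of y] \<rho> by (intro divide_left_mono) auto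
    also have "\<dots> \<le> K * \<bar>x - y\<bar> / \<rho>"
      using lipschitz_onD[OF K, of x y] \<rho> by (intro divide_right_mono) (auto simp: dist_real_def)
    finally show ?thesis by simp
  qed
  have "(K / \<rho>)-lipschitz_on UNIV (\<lambda>\<theta>. ln (f \<theta>))"
  proof (rule lipschitz_onI)
    show "dist (ln (f x)) (ln (f y)) \<le> K / \<rho> * dist x y" for x y
      using *[of x y] *[of y x] by (auto simp: dist_real_def abs_minus_commute abs_le_iff)
  qed (use lipschitz_on_nonneg[OF K] \<rho> in auto)
  thus ?thesis by (rule that)
qed

lemma curve_lipschitz:
  assumes "0 \<le> t" "t \<le> 1"
  obtains K where "K-lipschitz_on UNIV (\<lambda>\<theta>. x0 + of_real (t * f \<theta>) * cis \<theta>)"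
proof -
  obtain K where K: "K-lipschitz_on UNIV f" by (rule f_lipschitz)
  have "(K + m)-lipschitz_on UNIV (\<lambda>\<theta>. x0 + of_real (t * f \<theta>) * cis \<theta>)"
  proof (rule lipschitz_onI)
    fix x y :: real
    have "(x0 + of_real (t * f x) * cis x) - (x0 + of_real (t * f y) * cis y) =
       of_real t * (of_real (f x - f y) * cis x + of_real (f y) * (cis x - cis y))"
      by (simp add: algebra_simps)
    hence "dist (x0 + of_real (t * f x) * cis x) (x0 + of_real (t * f y) * cis y) =
       t * norm (of_real (f x - f y) * cis x + of_real (f y) * (cis x - cis y))"
      using assms by (simp only: dist_norm norm_mult norm_of_real abs_of_nonneg)
    also have "\<dots> \<le> norm (of_real (f x - f y) * cis x + of_real (f y) * (cis x - cis y))"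
      using assms by (intro mult_left_le_one_le) auto
    also have "\<dots> \<le> \<bar>f x - f y\<bar> + f y * norm (cis x - cis y)"
      using f_pos[of y] by (intro norm_triangle_le) (simp add: norm_mult flip: of_real_diff)
    also have "\<dots> \<le> K * \<bar>x - y\<bar> + m * \<bar>x - y\<bar>"
      using lipschitz_onD[OF K, of x y] f_pos[of y] f_le_m[of y] m_pos norm_cis_diff_le[of x y]
      by (intro add_mono mult_mono) (auto simp: dist_real_def)
    finally show "dist (x0 + of_real (t * f x) * cis x) (x0 + of_real (t * f y) * cis y) \<le> (K + m) * dist x y"
      by (simp add: dist_real_def algebra_simps)
  qed (use lipschitz_on_nonneg[OF K] m_pos in auto)
  thus ?thesis by (rule that)
qed

text \<open>The quotient \<open>q\<close> has a primitive \<open>Q\<close> on the starlike set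
  \<Omega>. What remains of the Cauchy integrand is \<open>\<Phi> x0 / (z - x0)\<close>, which
  integrates to a logarithm with increment \<open>2 * pi * \<i>\<close> over one turn.\<close>

lemma has_integral_polar_curve:
  assumes hol: "\<Phi> holomorphic_on \<Omega>" and t: "0 < t" "t < 1"
  shows "((\<lambda>\<theta>. \<Phi> (x0 + of_real (t * f \<theta>) * cis \<theta>) * (of_real (deriv f \<theta> / f \<theta>) + \<i>))
    has_integral (of_real (2 * pi) * \<i> * \<Phi> x0)) {0..2 * pi}"
proof -
  define q where "q z = (if z = x0 then deriv \<Phi> x0 else (\<Phi> z - \<Phi> x0) / (z - x0))" for z
  define \<gamma> where "\<gamma> \<theta> = x0 + of_real (t * f \<theta>) * cis \<theta>" for \<theta>
  have q: "q holomorphic_on \<Omega>" unfolding q_def using pole_lemma_open[OF hol op, of x0] by simp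
  have x0: "x0 \<in> \<Omega>" and "starlike \<Omega>"
    using star centre_in_ball unfolding strictly_star_shaped_at_def starlike_def by blast+
  then obtain Q where Q: "\<And>z. z \<in> \<Omega> \<Longrightarrow> (Q has_field_derivative q z) (at z)"
    using holomorphic_starlike_primitive[of \<Omega> q "{}"] q op
    by (auto simp: holomorphic_on_imp_continuous_on holomorphic_on_open field_differentiable_def)
  have holQ: "Q holomorphic_on \<Omega>" using Q op holomorphic_on_open by blast
  \<comment> \<open>As \<open>t < 1\<close>, the curve stays in a compact subset of \<Omega>; there
    \<open>Q\<close> is Lipschitz, as the fundamental theorem for Lipschitz functions
    demands.\<close>
  define S where "S = (\<lambda>z. x0 + of_real t * (z - x0)) ` frontier \<Omega>"
  have "compact (frontier \<Omega>)"
    using bdd bounded_subset[OF bounded_closure[OF bdd], of "frontier \<Omega>"] by (auto simp: compact_eq_bounded_closed frontier_def)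
  hence S: "compact S" unfolding S_def by (intro compact_continuous_image continuous_intros)
  have S\<Omega>: "S \<subseteq> \<Omega>"
  proof
    fix w assume "w \<in> S"
    then obtain z where z: "z \<in> frontier \<Omega>" "w = x0 + of_real t * (z - x0)" by (auto simp: S_def)
    thus "w \<in> \<Omega>"
      using strictly_star_shaped_below_frontier[OF star, of 1 "z - x0" t] t by auto
  qed
  have \<gamma>S: "\<gamma> \<theta> \<in> S" for \<theta>
    using polar_radius_frontier[of \<theta>] unfolding S_def \<gamma>_def
    by (intro image_eqI[of _ _ "x0 + of_real (f \<theta>) * cis \<theta>"]) (auto simp: f_def)
  obtain K1 where K1: "K1-lipschitz_on S Q" using holomorphic_lipschitz_on_compact[OF holQ op S S\<Omega>] .
  obtain K2 where K2: "K2-lipschitz_on UNIV \<gamma>" using curve_lipschitz[of t] t unfolding \<gamma>_def by auto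
  obtain K3 where K3: "K3-lipschitz_on UNIV (\<lambda>\<theta>. ln (f \<theta>))" by (rule ln_f_lipschitz)
  \<comment> \<open>An antiderivative of the integrand: the first summand accounts for
    \<open>\<Phi> - \<Phi> x0\<close>, the second for \<open>\<Phi> x0\<close> times the logarithm
    of \<open>z - x0\<close>, without its constant part \<open>ln t\<close>.\<close>
  define W where "W \<theta> = Q (\<gamma> \<theta>) + \<Phi> x0 * (of_real (ln (f \<theta>)) + \<i> * of_real \<theta>)" for \<theta>
  have L1: "(K1 * K2)-lipschitz_on UNIV (\<lambda>\<theta>. Q (\<gamma> \<theta>))"
    by (rule lipschitz_on_compose2[OF K2 lipschitz_on_subset[OF K1]]) (use \<gamma>S in auto)
  have L2: "(norm (\<Phi> x0) * (K3 + 1))-lipschitz_on UNIV (\<lambda>\<theta>. \<Phi> x0 * (of_real (ln (f \<theta>)) + \<i> * of_real \<theta>))"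
  proof (rule lipschitz_onI)
    fix x y :: real
    have "norm ((of_real (ln (f x)) + \<i> * of_real x) - (of_real (ln (f y)) + \<i> * of_real y))
      = norm (of_real (ln (f x) - ln (f y)) + \<i> * of_real (x - y))" by (simp add: algebra_simps)
    also have "\<dots> \<le> \<bar>ln (f x) - ln (f y)\<bar> + \<bar>x - y\<bar>"
      by (intro norm_triangle_le) (simp add: norm_mult flip: of_real_diff)
    also have "\<dots> \<le> (K3 + 1) * \<bar>x - y\<bar>" using lipschitz_onD[OF K3, of x y] by (simp add: dist_real_def algebra_simps)
    finally have "norm (\<Phi> x0) * norm ((of_real (ln (f x)) + \<i> * of_real x) - (of_real (ln (f y)) + \<i> * of_real y)) \<le> norm (\<Phi> x0) * ((K3 + 1) * \<bar>x - y\<bar>)"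
      by (intro mult_left_mono) auto
    thus "dist (\<Phi> x0 * (of_real (ln (f x)) + \<i> * of_real x)) (\<Phi> x0 * (of_real (ln (f y)) + \<i> * of_real y)) \<le> norm (\<Phi> x0) * (K3 + 1) * dist x y"
      by (simp only: dist_norm dist_real_def mult.assoc real_norm_def flip: right_diff_distrib norm_mult)
  qed (use lipschitz_on_nonneg[OF K3] in auto)
  obtain K where K: "K-lipschitz_on UNIV W" unfolding W_def[abs_def] using lipschitz_on_add[OF L1 L2] by blast
  obtain K0 where K0: "K0-lipschitz_on UNIV f" by (rule f_lipschitz)
  have neg: "negligible {\<theta>. \<not> f differentiable at \<theta>}" by (rule lipschitz_differentiable_ae[OF K0])
  have "((\<lambda>\<theta>. \<Phi> (\<gamma> \<theta>) * (of_real (deriv f \<theta> / f \<theta>) + \<i>)) has_integral (W (2 * pi) - W 0)) {0..2 * pi}"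
  proof (rule has_integral_derivative_lipschitz[OF K neg])
    fix \<theta> assume "\<theta> \<notin> {\<theta>. \<not> f differentiable at \<theta>}"
    hence f': "(f has_real_derivative deriv f \<theta>) (at \<theta>)"
      by (metis DERIV_deriv_iff_real_differentiable mem_Collect_eq)
    define c where "c = of_real (deriv f \<theta> / f \<theta>) + \<i>"
    have f0: "f \<theta> > 0" by (rule f_pos)
    have cis': "(cis has_vector_derivative (\<i> * cis \<theta>)) (at \<theta>)"
      unfolding cis_conv_exp by (auto intro!: derivative_eq_intros has_vector_derivative_real_field)
    have rf': "((\<lambda>\<theta>. complex_of_real (t * f \<theta>)) has_vector_derivative of_real (t * deriv f \<theta>)) (at \<theta>)"
      by (intro has_vector_derivative_of_real DERIV_cmult f'[unfolded has_real_derivative_iff_has_vector_derivative] f')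
    have "(\<gamma> has_vector_derivative (of_real (t * f \<theta>) * (\<i> * cis \<theta>) + of_real (t * deriv f \<theta>) * cis \<theta>)) (at \<theta>)"
      unfolding \<gamma>_def[abs_def] using has_vector_derivative_add[OF has_vector_derivative_const[of x0] has_vector_derivative_mult[OF rf' cis']]
      by simp
    moreover have "of_real (t * f \<theta>) * (\<i> * cis \<theta>) + of_real (t * deriv f \<theta>) * cis \<theta> = (\<gamma> \<theta> - x0) * c"
      using f0 by (simp add: \<gamma>_def c_def field_simps)
    ultimately have \<gamma>': "(\<gamma> has_vector_derivative ((\<gamma> \<theta> - x0) * c)) (at \<theta>)" by simp
    have "\<gamma> \<theta> \<in> \<Omega>" using \<gamma>S S\<Omega> by blast
    hence "((\<lambda>\<theta>. Q (\<gamma> \<theta>)) has_vector_derivative ((\<gamma> \<theta> - x0) * c * q (\<gamma> \<theta>))) (at \<theta>)"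
      using field_vector_diff_chain_at[OF \<gamma>' Q] by (simp add: o_def)
    moreover have "\<gamma> \<theta> \<noteq> x0" using f0 t by (simp add: \<gamma>_def)
    hence "(\<gamma> \<theta> - x0) * c * q (\<gamma> \<theta>) = (\<Phi> (\<gamma> \<theta>) - \<Phi> x0) * c" by (simp add: q_def)
    ultimately have 1: "((\<lambda>\<theta>. Q (\<gamma> \<theta>)) has_vector_derivative ((\<Phi> (\<gamma> \<theta>) - \<Phi> x0) * c)) (at \<theta>)" by simp
    have ln': "((\<lambda>\<theta>. ln (f \<theta>)) has_real_derivative deriv f \<theta> / f \<theta>) (at \<theta>)"
      using f' f0 by (auto intro!: derivative_eq_intros)
    have 2: "((\<lambda>\<theta>. \<Phi> x0 * (of_real (ln (f \<theta>)) + \<i> * of_real \<theta>)) has_vector_derivative \<Phi> x0 * c) (at \<theta>)"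
      unfolding c_def
      by (intro has_vector_derivative_mult_right has_vector_derivative_add has_vector_derivative_of_real[OF ln'])
         (auto intro!: derivative_eq_intros has_vector_derivative_of_real)
    show "(W has_vector_derivative \<Phi> (\<gamma> \<theta>) * (of_real (deriv f \<theta> / f \<theta>) + \<i>)) (at \<theta>)"
      using has_vector_derivative_add[OF 1 2] unfolding W_def[abs_def] c_def[symmetric] by (simp add: left_diff_distrib)
  qed simp
  \<comment> \<open>By periodicity of \<open>f\<close>, both \<open>Q (\<gamma> \<theta>)\<close>
    and \<open>ln (f \<theta>)\<close> return to their initial values; only the angle
    contributes.\<close>
  moreover have "W (2 * pi) - W 0 = of_real (2 * pi) * \<i> * \<Phi> x0"
  proof -
    have f2: "f (2 * pi) = f 0" using polar_radius_periodic[of 0] by (simp add: f_def)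
    hence "\<gamma> (2 * pi) = \<gamma> 0" by (simp add: \<gamma>_def)
    thus ?thesis by (simp add: W_def f2 right_diff_distrib[symmetric])
  qed
  ultimately show ?thesis by (simp add: \<gamma>_def)
qed

text \<open>The weight \<open>f^2\<close> is the angular factor of the area element in
  \<open>nn_integral_star_domain\<close>, and \<open>C\<close> is the same for all \<open>t\<close>,
  so these bounds can be integrated over \<open>t\<close>.\<close>

lemma curve_integral_le:
  assumes hol: "F holomorphic_on \<Omega>" and F0: "Re (F x0) = 0" and t: "0 < t" "t < 1" and \<alpha>: "0 < \<alpha>" "\<alpha> < 1"
    and P: "\<And>\<theta>. (\<lambda>\<theta>. f \<theta> / m) differentiable at \<theta> \<Longrightarrow> HP_P (\<lambda>\<theta>. f \<theta> / m) \<alpha> \<theta> \<le> C"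
  shows "integral {0..2 * pi} (\<lambda>\<theta>. (f \<theta>)\<^sup>2 * (Re (F (x0 + of_real (t * f \<theta>) * cis \<theta>)))\<^sup>2) \<le>
    C * integral {0..2 * pi} (\<lambda>\<theta>. (f \<theta>)\<^sup>2 * (Im (F (x0 + of_real (t * f \<theta>) * cis \<theta>)))\<^sup>2)" (is "integral _ ?H \<le> C * integral _ ?G")
proof -
  define \<gamma> where "\<gamma> \<theta> = x0 + of_real (t * f \<theta>) * cis \<theta>" for \<theta>
  define h where "h \<theta> = Re (F (\<gamma> \<theta>))" for \<theta>
  define g where "g \<theta> = Im (F (\<gamma> \<theta>))" for \<theta>
  define d where "d \<theta> = deriv f \<theta> / f \<theta>" for \<theta>
  define N where "N = {\<theta>. \<not> f differentiable at \<theta>}"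
  obtain K0 where K0: "K0-lipschitz_on UNIV f" by (rule f_lipschitz)
  have neg: "negligible N" unfolding N_def by (rule lipschitz_differentiable_ae[OF K0])
  have cont\<gamma>: "continuous_on {0..2 * pi} \<gamma>"
    unfolding \<gamma>_def by (intro continuous_intros f_continuous)
  have "continuous_on {0..2 * pi} (\<lambda>\<theta>. F (\<gamma> \<theta>))"
    by (rule continuous_on_compose2[OF holomorphic_on_imp_continuous_on[OF hol] cont\<gamma>])
       (use curve_mem t in \<open>auto simp: \<gamma>_def\<close>)
  hence int: "?H integrable_on {0..2 * pi}" "?G integrable_on {0..2 * pi}"
    unfolding \<gamma>_def by (auto intro!: integrable_continuous_interval continuous_intros f_continuous)
  have "((\<lambda>\<theta>. (h \<theta>)\<^sup>2 - (g \<theta>)\<^sup>2 + 2 * h \<theta> * g \<theta> * d \<theta>) has_integral (- (2 * pi * (Im (F x0))\<^sup>2))) {0..2 * pi}"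
  proof -
    have "(\<lambda>z. (F z)\<^sup>2) holomorphic_on \<Omega>" using hol by (intro holomorphic_intros)
    from has_integral_linear[OF has_integral_polar_curve[OF this t] bounded_linear_Im]
    show ?thesis using F0
      by (simp add: o_def h_def g_def d_def \<gamma>_def power2_eq_square algebra_simps)
  qed
  \<comment> \<open>\<open>has_integral_le\<close> requires the inequality at every angle, so on the
    null set \<open>N\<close> the integrand is replaced by the function that is to lie below
    it.\<close>
  hence RHS: "((\<lambda>\<theta>. if \<theta> \<in> N then \<alpha> / m\<^sup>2 * (?H \<theta> - C * ?G \<theta>) else (h \<theta>)\<^sup>2 - (g \<theta>)\<^sup>2 + 2 * h \<theta> * g \<theta> * d \<theta>)
    has_integral (- (2 * pi * (Im (F x0))\<^sup>2))) {0..2 * pi}"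
    by (rule has_integral_spike[OF neg, rotated]) auto
  have LHS: "((\<lambda>\<theta>. \<alpha> / m\<^sup>2 * (?H \<theta> - C * ?G \<theta>)) has_integral \<alpha> / m\<^sup>2 * (integral {0..2 * pi} ?H - C * integral {0..2 * pi} ?G)) {0..2 * pi}"
    using int by (intro has_integral_mult_right has_integral_diff integrable_integral)
  have "\<alpha> / m\<^sup>2 * (integral {0..2 * pi} ?H - C * integral {0..2 * pi} ?G) \<le> - (2 * pi * (Im (F x0))\<^sup>2)"
  proof (rule has_integral_le[OF LHS RHS])
    fix \<theta>
    have "\<alpha> / m\<^sup>2 * (?H \<theta> - C * ?G \<theta>) \<le> (h \<theta>)\<^sup>2 - (g \<theta>)\<^sup>2 + 2 * h \<theta> * g \<theta> * d \<theta>" if "\<theta> \<notin> N"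
    proof -
      have fd: "f differentiable at \<theta>" using that by (simp add: N_def)
      define a where "a = f \<theta> / m"
      define s where "s = 1 - \<alpha> * a\<^sup>2"
      have a: "0 < a" "a \<le> 1" using f_pos[of \<theta>] f_le_m[of \<theta>] m_pos by (auto simp: a_def)
      hence "a\<^sup>2 \<le> 1" by (simp add: power_le_one)
      hence "\<alpha> * a\<^sup>2 \<le> \<alpha>" using \<alpha> by (simp add: mult_left_le)
      hence s: "s > 0" using \<alpha> unfolding s_def by linarith
      have "(f has_real_derivative deriv f \<theta>) (at \<theta>)" using fd by (metis DERIV_deriv_iff_real_differentiable)
      hence df: "((\<lambda>\<theta>. f \<theta> / m) has_real_derivative deriv f \<theta> / m) (at \<theta>)"
        using m_pos by (auto intro!: derivative_eq_intros)
      hence "HP_P (\<lambda>\<theta>. f \<theta> / m) \<alpha> \<theta> \<le> C" using P real_differentiable_def by blast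
      moreover have "HP_P (\<lambda>\<theta>. f \<theta> / m) \<alpha> \<theta> = 1 / (\<alpha> * a\<^sup>2) * (1 + (deriv f \<theta> / m)\<^sup>2 / (a\<^sup>2 - \<alpha> * a ^ 4))"
        using DERIV_imp_deriv[OF df] by (simp add: HP_P_def a_def)
      \<comment> \<open>In terms of \<open>s\<close> and the logarithmic derivative
        \<open>d\<close>, \<open>HP_P\<close> becomes
        \<open>(1 + d^2 / s) / (\<alpha> * a^2)\<close>, so its bound \<open>C\<close> controls the
        coefficient of \<open>g^2\<close>.\<close>
      moreover have "(deriv f \<theta> / m)\<^sup>2 / (a\<^sup>2 - \<alpha> * a ^ 4) = (d \<theta>)\<^sup>2 / s"
      proof -
        have "deriv f \<theta> / m = d \<theta> * a" using f_pos[of \<theta>] m_pos by (simp add: d_def a_def)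
        moreover have "a\<^sup>2 - \<alpha> * a ^ 4 = s * a\<^sup>2" by (simp add: s_def algebra_simps power2_eq_square power4_eq_xxxx)
        ultimately show ?thesis using a by (simp add: power_mult_distrib)
      qed
      ultimately have "1 / (\<alpha> * a\<^sup>2) * (1 + (d \<theta>)\<^sup>2 / s) \<le> C" by simp
      hence "1 + (d \<theta>)\<^sup>2 / s \<le> C * (\<alpha> * a\<^sup>2)" using \<alpha> a by (simp add: pos_divide_le_eq)
      hence 1: "(1 + (d \<theta>)\<^sup>2 / s) * (g \<theta>)\<^sup>2 \<le> C * (\<alpha> * a\<^sup>2) * (g \<theta>)\<^sup>2" by (intro mult_right_mono) auto
      \<comment> \<open>The square gives
        \<open>- 2 * h * g * d \<le> s * h^2 + d^2 / s * g^2\<close>. With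
        \<open>s = 1 - \<alpha> * a^2\<close>, exactly \<open>\<alpha> * a^2 * h^2\<close> is left
        of the term \<open>h^2\<close>.\<close>
      have "0 \<le> (s * h \<theta> + g \<theta> * d \<theta>)\<^sup>2 / s" using s by simp
      also have "\<dots> = s * (h \<theta>)\<^sup>2 + 2 * h \<theta> * g \<theta> * d \<theta> + (d \<theta>)\<^sup>2 / s * (g \<theta>)\<^sup>2"
        using s by (simp add: field_simps power2_eq_square)
      finally have "\<alpha> * a\<^sup>2 * (h \<theta>)\<^sup>2 - C * (\<alpha> * a\<^sup>2) * (g \<theta>)\<^sup>2 \<le> (h \<theta>)\<^sup>2 - (g \<theta>)\<^sup>2 + 2 * h \<theta> * g \<theta> * d \<theta>"
        using 1 by (simp add: s_def algebra_simps)
      moreover have "\<alpha> / m\<^sup>2 * (?H \<theta> - C * ?G \<theta>) = \<alpha> * a\<^sup>2 * (h \<theta>)\<^sup>2 - C * (\<alpha> * a\<^sup>2) * (g \<theta>)\<^sup>2"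
        by (simp add: a_def h_def g_def \<gamma>_def power_divide diff_divide_distrib algebra_simps)
      ultimately show ?thesis by simp
    qed
    thus "\<alpha> / m\<^sup>2 * (?H \<theta> - C * ?G \<theta>) \<le> (if \<theta> \<in> N then \<alpha> / m\<^sup>2 * (?H \<theta> - C * ?G \<theta>) else (h \<theta>)\<^sup>2 - (g \<theta>)\<^sup>2 + 2 * h \<theta> * g \<theta> * d \<theta>)"
      by auto
  qed
  also have "\<dots> \<le> 0" by simp
  finally show ?thesis using \<alpha> m_pos by (simp add: mult_le_0_iff divide_le_0_iff zero_less_mult_iff)
qed

section \<open>Area integrals as integrals over the dilated curves\<close>

text \<open>Polar coordinates are followed by \<open>r = t * f \<theta>\<close> at a fixed angle,
  whence the two exchanges of the order of integration. One factor \<open>f \<theta>\<close> comes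
  from \<open>dr\<close>, the other from \<open>r\<close>, and membership in \<Omega> becomes
  \<open>t < 1\<close>.\<close>

lemma nn_integral_star_domain:
  fixes \<phi> :: "complex \<Rightarrow> ennreal"
  assumes [measurable]: "\<phi> \<in> borel_measurable borel"
  shows "(\<integral>\<^sup>+z. \<phi> z * indicator \<Omega> z \<partial>lborel) =
    (\<integral>\<^sup>+t. ennreal t * indicator {0..<1} t *
       (\<integral>\<^sup>+\<theta>. ennreal ((f \<theta>)\<^sup>2) * \<phi> (x0 + of_real (t * f \<theta>) * cis \<theta>) * indicator {0..<2*pi} \<theta> \<partial>lborel) \<partial>lborel)"
proof -
  have \<Omega>_meas [measurable]: "\<Omega> \<in> sets borel" using op by simp
  define \<psi> where "\<psi> z = \<phi> z * indicator \<Omega> z" for z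
  have \<psi>_meas [measurable]: "\<psi> \<in> borel_measurable borel" unfolding \<psi>_def by measurable
  define p where "p r \<theta> = ennreal r * indicator {0..} r * (\<psi> (x0 + of_real r * cis \<theta>) * indicator {0..<2*pi} \<theta>)" for r \<theta> :: real
  have "(\<integral>\<^sup>+z. \<psi> z \<partial>lborel) = (\<integral>\<^sup>+z. \<psi> z \<partial>distr lborel borel ((+) x0))" by (simp add: lborel_distr_plus)
  also have "\<dots> = (\<integral>\<^sup>+z. \<psi> (x0 + z) \<partial>lborel)" by (subst nn_integral_distr) auto
  also have "\<dots> = (\<integral>\<^sup>+r. \<integral>\<^sup>+\<theta>. p r \<theta> \<partial>lborel \<partial>lborel)"
    unfolding p_def by (subst nn_integral_polar) (auto intro!: nn_integral_cong nn_integral_cmult[symmetric])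
  also have "\<dots> = (\<integral>\<^sup>+\<theta>. \<integral>\<^sup>+r. p r \<theta> \<partial>lborel \<partial>lborel)"
    unfolding p_def by (rule lborel_pair.Fubini'[symmetric]) measurable
  also have "\<dots> = (\<integral>\<^sup>+\<theta>. \<integral>\<^sup>+t. ennreal (f \<theta>) * p (t * f \<theta>) \<theta> \<partial>lborel \<partial>lborel)"
  proof (rule nn_integral_cong)
    fix \<theta> :: real
    have [measurable]: "(\<lambda>r. p r \<theta>) \<in> borel_measurable borel" unfolding p_def by measurable
    have "(\<integral>\<^sup>+r. p r \<theta> \<partial>lborel) = ennreal \<bar>f \<theta>\<bar> * (\<integral>\<^sup>+t. p (0 + f \<theta> * t) \<theta> \<partial>lborel)"
      by (rule nn_integral_real_affine) (use f_pos[of \<theta>] in auto)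
    also have "\<dots> = (\<integral>\<^sup>+t. ennreal (f \<theta>) * p (t * f \<theta>) \<theta> \<partial>lborel)"
      using f_pos[of \<theta>] by (subst nn_integral_cmult) (auto simp: mult.commute)
    finally show "(\<integral>\<^sup>+r. p r \<theta> \<partial>lborel) = (\<integral>\<^sup>+t. ennreal (f \<theta>) * p (t * f \<theta>) \<theta> \<partial>lborel)" .
  qed
  also have "\<dots> = (\<integral>\<^sup>+t. \<integral>\<^sup>+\<theta>. ennreal (f \<theta>) * p (t * f \<theta>) \<theta> \<partial>lborel \<partial>lborel)"
    unfolding p_def by (rule lborel_pair.Fubini') measurable
  also have "\<dots> = (\<integral>\<^sup>+t. \<integral>\<^sup>+\<theta>. ennreal t * indicator {0..<1} t *
       (ennreal ((f \<theta>)\<^sup>2) * \<phi> (x0 + of_real (t * f \<theta>) * cis \<theta>) * indicator {0..<2*pi} \<theta>) \<partial>lborel \<partial>lborel)"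
  proof (intro nn_integral_cong)
    fix t \<theta> :: real
    have f0: "f \<theta> > 0" by (rule f_pos)
    show "ennreal (f \<theta>) * p (t * f \<theta>) \<theta> = ennreal t * indicator {0..<1} t *
       (ennreal ((f \<theta>)\<^sup>2) * \<phi> (x0 + of_real (t * f \<theta>) * cis \<theta>) * indicator {0..<2*pi} \<theta>)"
    proof (cases "t \<ge> 0")
      case True
      have "x0 + of_real (t * f \<theta>) * cis \<theta> \<in> \<Omega> \<longleftrightarrow> t < 1"
        using True f0 by (subst mem_iff_less_polar_radius) (auto simp flip: f_def)
      hence "indicator \<Omega> (x0 + of_real (t * f \<theta>) * cis \<theta>) = (indicator {0..<1} t :: ennreal)"
        using True by (auto simp: indicator_def)
      moreover have "ennreal (t * f \<theta>) = ennreal t * ennreal (f \<theta>)" "ennreal ((f \<theta>)\<^sup>2) = ennreal (f \<theta>) * ennreal (f \<theta>)"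
        using True f0 by (auto simp: ennreal_mult power2_eq_square)
      moreover have "indicator {0..} (t * f \<theta>) = (1::ennreal)" using True f0 by simp
      ultimately show ?thesis by (simp only: p_def \<psi>_def) (simp add: mult_ac)
    next
      case False
      thus ?thesis using f0 by (simp add: p_def zero_le_mult_iff)
    qed
  qed
  also have "\<dots> = (\<integral>\<^sup>+t. ennreal t * indicator {0..<1} t *
       (\<integral>\<^sup>+\<theta>. ennreal ((f \<theta>)\<^sup>2) * \<phi> (x0 + of_real (t * f \<theta>) * cis \<theta>) * indicator {0..<2*pi} \<theta> \<partial>lborel) \<partial>lborel)"
    by (intro nn_integral_cong nn_integral_cmult) measurable
  finally show ?thesis by (simp add: \<psi>_def)
qed

text \<open>This links the Lebesgue integral over the half-open period in the polar formula with the
  gauge integral over the closed period in the curve estimate; the extra endpoint is a null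
  set.\<close>

lemma nn_integral_curve:
  assumes u: "continuous_on \<Omega> u" "\<And>z. u z \<ge> 0" "u \<in> borel_measurable borel" and t: "0 \<le> t" "t < 1"
  shows "(\<integral>\<^sup>+\<theta>. ennreal ((f \<theta>)\<^sup>2) * ennreal (u (x0 + of_real (t * f \<theta>) * cis \<theta>)) * indicator {0..<2*pi} \<theta> \<partial>lborel) =
    ennreal (integral {0..2 * pi} (\<lambda>\<theta>. (f \<theta>)\<^sup>2 * u (x0 + of_real (t * f \<theta>) * cis \<theta>)))"
    (is "_ = ennreal (integral _ ?k)")
proof -
  note [measurable] = u(3)
  have cu: "continuous_on {0..2 * pi} (\<lambda>\<theta>. u (x0 + of_real (t * f \<theta>) * cis \<theta>))"
    by (rule continuous_on_compose2[OF u(1)]) (use curve_mem t in \<open>auto intro!: continuous_intros f_continuous\<close>)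
  have "(?k has_integral integral {0..2 * pi} ?k) {0..2 * pi}"
    by (intro integrable_integral integrable_continuous_interval continuous_intros cu f_continuous)
  hence hi: "(?k has_integral integral {0..2 * pi} ?k) {0..<2 * pi}"
    by (rule has_integral_spike_set_eq[THEN iffD1, rotated 2])
       (rule negligible_subset[of "{2 * pi}"]; auto)+
  have "(\<integral>\<^sup>+\<theta>. ennreal ((f \<theta>)\<^sup>2) * ennreal (u (x0 + of_real (t * f \<theta>) * cis \<theta>)) * indicator {0..<2*pi} \<theta> \<partial>lborel) =
    (\<integral>\<^sup>+\<theta>. ennreal (indicator {0..<2*pi} \<theta> * ?k \<theta>) \<partial>lborel)"
    using u(2) by (intro nn_integral_cong) (auto simp: indicator_def ennreal_mult)
  also have "\<dots> = ennreal (integral {0..2 * pi} ?k)"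
  proof (rule nn_integral_has_integral_lborel)
    have "(\<lambda>\<theta>. indicator {0..<2*pi} \<theta> * ?k \<theta>) = (\<lambda>\<theta>. if \<theta> \<in> {0..<2*pi} then ?k \<theta> else 0)"
      by (auto simp: indicator_def)
    thus "((\<lambda>\<theta>. indicator {0..<2*pi} \<theta> * ?k \<theta>) has_integral integral {0..2 * pi} ?k) UNIV"
      using hi by (simp only: has_integral_restrict_UNIV)
  qed (use u(2) in auto)
  finally show ?thesis .
qed

lemma nn_integral_Re_le_Im:
  assumes hol: "F holomorphic_on \<Omega>" and F0: "Re (F x0) = 0" and \<alpha>: "0 < \<alpha>" "\<alpha> < 1" and C: "C \<ge> 0"
    and P: "\<And>\<theta>. (\<lambda>\<theta>. f \<theta> / m) differentiable at \<theta> \<Longrightarrow> HP_P (\<lambda>\<theta>. f \<theta> / m) \<alpha> \<theta> \<le> C"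
  shows "(\<integral>\<^sup>+z. ennreal ((Re (F z))\<^sup>2) * indicator \<Omega> z \<partial>lborel) \<le> ennreal C * (\<integral>\<^sup>+z. ennreal ((Im (F z))\<^sup>2) * indicator \<Omega> z \<partial>lborel)"
proof -
  \<comment> \<open>Nothing is known of \<open>F\<close> outside \<Omega>. Its extension by zero is
    Borel on the whole plane, as the polar formula requires, and agrees with \<open>F\<close> on the
    curves with \<open>0 < t < 1\<close>.\<close>
  define G where "G z = indicator \<Omega> z *\<^sub>R F z" for z
  have contF: "continuous_on \<Omega> F" using hol by (rule holomorphic_on_imp_continuous_on)
  have [measurable]: "G \<in> borel_measurable borel"
    unfolding G_def[abs_def] using op contF by (intro borel_measurable_continuous_on_indicator) auto
  have contG: "continuous_on \<Omega> G" using contF by (rule continuous_on_eq) (auto simp: G_def)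
  define J where "J u t = (\<integral>\<^sup>+\<theta>. ennreal ((f \<theta>)\<^sup>2) * ennreal ((u (G (x0 + of_real (t * f \<theta>) * cis \<theta>)))\<^sup>2) * indicator {0..<2*pi} \<theta> \<partial>lborel)"
    for u :: "complex \<Rightarrow> real" and t :: real
  have polar: "(\<integral>\<^sup>+z. ennreal ((u (F z))\<^sup>2) * indicator \<Omega> z \<partial>lborel) = (\<integral>\<^sup>+t. ennreal t * indicator {0..<1} t * J u t \<partial>lborel)"
    if [measurable]: "u \<in> borel_measurable borel" for u
  proof -
    have "(\<integral>\<^sup>+z. ennreal ((u (F z))\<^sup>2) * indicator \<Omega> z \<partial>lborel) = (\<integral>\<^sup>+z. ennreal ((u (G z))\<^sup>2) * indicator \<Omega> z \<partial>lborel)"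
      by (intro nn_integral_cong) (auto simp: indicator_def G_def)
    also have "\<dots> = (\<integral>\<^sup>+t. ennreal t * indicator {0..<1} t * J u t \<partial>lborel)"
      unfolding J_def by (rule nn_integral_star_domain) measurable
    finally show ?thesis .
  qed
  have J: "J u t = ennreal (integral {0..2 * pi} (\<lambda>\<theta>. (f \<theta>)\<^sup>2 * (u (F (x0 + of_real (t * f \<theta>) * cis \<theta>)))\<^sup>2))"
    if [measurable]: "u \<in> borel_measurable borel" and u: "continuous_on UNIV u" and t: "0 < t" "t < 1" for u t
  proof -
    have GF: "G (x0 + of_real (t * f \<theta>) * cis \<theta>) = F (x0 + of_real (t * f \<theta>) * cis \<theta>)" for \<theta>
      using curve_mem[of t \<theta>] t by (simp add: G_def)
    have "J u t = ennreal (integral {0..2 * pi} (\<lambda>\<theta>. (f \<theta>)\<^sup>2 * (u (G (x0 + of_real (t * f \<theta>) * cis \<theta>)))\<^sup>2))"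
      unfolding J_def
      by (rule nn_integral_curve) (use t in \<open>auto intro!: continuous_intros continuous_on_compose2[OF u contG]\<close>)
    thus ?thesis by (simp only: GF)
  qed
  have [measurable]: "J Im \<in> borel_measurable borel" unfolding J_def by measurable
  have "(\<integral>\<^sup>+z. ennreal ((Re (F z))\<^sup>2) * indicator \<Omega> z \<partial>lborel) = (\<integral>\<^sup>+t. ennreal t * indicator {0..<1} t * J Re t \<partial>lborel)"
    by (rule polar) measurable
  also have "\<dots> \<le> (\<integral>\<^sup>+t. ennreal C * (ennreal t * indicator {0..<1} t * J Im t) \<partial>lborel)"
  proof (intro nn_integral_mono)
    fix t :: real
    show "ennreal t * indicator {0..<1} t * J Re t \<le> ennreal C * (ennreal t * indicator {0..<1} t * J Im t)"
    \<comment> \<open>For all other \<open>t\<close> both sides vanish, at \<open>t = 0\<close>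
      because of the factor \<open>t\<close>.\<close>
    proof (cases "0 < t \<and> t < 1")
      case True
      have "J Re t \<le> ennreal C * J Im t"
        using curve_integral_le[OF hol F0 _ _ \<alpha> P, of t] True C
        by (simp add: J continuous_intros ennreal_leI flip: ennreal_mult')
      hence "ennreal t * J Re t \<le> ennreal t * (ennreal C * J Im t)" by (intro mult_left_mono) auto
      thus ?thesis using True by (simp add: mult_ac)
    qed (auto simp: indicator_def)
  qed
  also have "\<dots> = ennreal C * (\<integral>\<^sup>+t. ennreal t * indicator {0..<1} t * J Im t \<partial>lborel)"
    by (rule nn_integral_cmult) measurable
  also have "(\<integral>\<^sup>+t. ennreal t * indicator {0..<1} t * J Im t \<partial>lborel) = (\<integral>\<^sup>+z. ennreal ((Im (F z))\<^sup>2) * indicator \<Omega> z \<partial>lborel)"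
    by (rule polar[symmetric]) measurable
  finally show ?thesis .
qed

lemma HP_P_nonneg:
  assumes \<alpha>: "0 < \<alpha>" "\<alpha> < 1"
  shows "HP_P (\<lambda>\<theta>. f \<theta> / m) \<alpha> \<theta> \<ge> 0"
proof -
  define a where "a = f \<theta> / m"
  have a: "0 < a" "a \<le> 1"
    using f_pos[of \<theta>] f_le_m[of \<theta>] m_pos by (auto simp: a_def f_def m_def)
  hence "a\<^sup>2 \<le> 1" by (simp add: power_le_one)
  hence "\<alpha> * a\<^sup>2 \<le> 1 * 1" using \<alpha> by (intro mult_mono) auto
  moreover have "a\<^sup>2 - \<alpha> * a ^ 4 = a\<^sup>2 * (1 - \<alpha> * a\<^sup>2)" by (simp add: algebra_simps power2_eq_square power4_eq_xxxx)
  ultimately have "a\<^sup>2 - \<alpha> * a ^ 4 \<ge> 0" by simp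
  thus ?thesis using \<alpha> unfolding HP_P_def a_def[symmetric] by (intro mult_nonneg_nonneg add_nonneg_nonneg divide_nonneg_nonneg) auto
qed

text \<open>The supremum of \<open>HP_P\<close> thus has a nonempty index set and cannot be
  \<open>-\<infinity>\<close>; with \<open>HP_P_nonneg\<close> it is nonnegative.\<close>

lemma exists_differentiable: "\<exists>\<theta>. (\<lambda>\<theta>. f \<theta> / m) differentiable at \<theta>"
proof -
  obtain K where "K-lipschitz_on UNIV f" using polar_radius_lipschitz by (auto simp: f_def)
  hence "negligible {\<theta>. \<not> f differentiable at \<theta>}" by (rule lipschitz_differentiable_ae)
  hence "{\<theta>. \<not> f differentiable at \<theta>} \<noteq> UNIV" using non_negligible_UNIV by metis
  then obtain \<theta> where "f differentiable at \<theta>" by blast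
  hence "(\<lambda>\<theta>. f \<theta> * (1 / m)) differentiable at \<theta>" by (intro differentiable_mult) auto
  thus ?thesis by auto
qed

end

section \<open>From the curve estimates to the Friedrichs constant\<close>

text \<open>Constants are integrable on a bounded open set, so domination applies. This serves for
  \<open>F\<close> itself, for the squares of its parts and for the shifted square of its real
  part.\<close>

lemma set_integrable_square_bound:
  fixes g :: "complex \<Rightarrow> 'a::euclidean_space"
  assumes op: "open \<Omega>" and bdd: "bounded \<Omega>" and g: "continuous_on \<Omega> g"
    and int: "set_integrable lborel \<Omega> (\<lambda>z. (cmod (F z))\<^sup>2)"
    and bound: "\<And>z. z \<in> \<Omega> \<Longrightarrow> norm (g z) \<le> A + B * (cmod (F z))\<^sup>2"
  shows "set_integrable lborel \<Omega> g"
proof -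
  have "set_integrable lborel \<Omega> (\<lambda>_. A)"
    using op emeasure_bounded_finite[OF bdd] unfolding set_integrable_def by (intro integrable_scaleR_left) (auto simp: integrable_indicator_iff)
  hence "set_integrable lborel \<Omega> (\<lambda>z. A + B * (cmod (F z))\<^sup>2)"
    using int by (intro set_integral_add(1)) auto
  thus ?thesis unfolding set_integrable_def
  proof (rule Bochner_Integration.integrable_bound)
    show "(\<lambda>z. indicator \<Omega> z *\<^sub>R g z) \<in> borel_measurable lborel"
      using op g by (simp add: borel_measurable_continuous_on_indicator)
    show "AE z in lborel. norm (indicator \<Omega> z *\<^sub>R g z) \<le> norm (indicator \<Omega> z *\<^sub>R (A + B * (cmod (F z))\<^sup>2))"
      using bound by (intro AE_I2) (auto simp: indicator_def intro: order_trans[OF _ abs_ge_self])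
  qed
qed

theorem theorem4p4:
  fixes \<Omega> :: "complex set" and x0 :: complex
  assumes "domain_in_plane \<Omega>" and "bounded \<Omega>" and "strictly_star_shaped_at x0 \<Omega>"
  shows "friedrichs_constant \<Omega> \<le> HP_M x0 \<Omega>"
proof -
  have op: "open \<Omega>" using assms(1) by (simp add: domain_in_plane_def)
  interpret star_shaped_domain \<Omega> x0 by unfold_locales (use op assms in auto)
  have norm: "polar_radius x0 (normalized_domain x0 \<Omega>) = (\<lambda>\<theta>. f \<theta> / m)"
    using polar_radius_normalized_domain by (auto simp: f_def m_def)
  have "friedrichs_constant \<Omega> \<le> (SUP \<theta>\<in>{\<theta>. (\<lambda>\<theta>. f \<theta> / m) differentiable (at \<theta>)}. ereal (HP_P (\<lambda>\<theta>. f \<theta> / m) \<alpha> \<theta>))"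
    if \<alpha>: "0 < \<alpha>" "\<alpha> < 1" for \<alpha>
  \<comment> \<open>A finite supremum \<open>C\<close> is shown to be an admissible constant in the
    definition of \<open>friedrichs_constant\<close>. The value \<open>\<infinity>\<close> is
    trivial, and \<open>-\<infinity>\<close> is excluded by a point of differentiability.\<close>
  proof (cases "(SUP \<theta>\<in>{\<theta>. (\<lambda>\<theta>. f \<theta> / m) differentiable (at \<theta>)}. ereal (HP_P (\<lambda>\<theta>. f \<theta> / m) \<alpha> \<theta>))")
    case (real C)
    have P: "HP_P (\<lambda>\<theta>. f \<theta> / m) \<alpha> \<theta> \<le> C" if "(\<lambda>\<theta>. f \<theta> / m) differentiable at \<theta>" for \<theta>
    proof -
      have "ereal (HP_P (\<lambda>\<theta>. f \<theta> / m) \<alpha> \<theta>) \<le> ereal C" unfolding real[symmetric] using that by (intro SUP_upper) auto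
      thus ?thesis by simp
    qed
    obtain \<theta>0 where "(\<lambda>\<theta>. f \<theta> / m) differentiable at \<theta>0" using exists_differentiable by blast
    hence C: "C \<ge> 0" using P[of \<theta>0] HP_P_nonneg[OF \<alpha>, of \<theta>0] by linarith
    have "(LINT z:\<Omega>|lborel. (Re (F z))\<^sup>2) \<le> C * (LINT z:\<Omega>|lborel. (Im (F z))\<^sup>2)" if F: "F \<in> friedrichs_space \<Omega>" for F
    proof -
      have hol: "F holomorphic_on \<Omega>" and int: "set_integrable lborel \<Omega> (\<lambda>z. (cmod (F z))\<^sup>2)"
        and mean: "(LINT z:\<Omega>|lborel. F z) = 0"
        using F by (auto simp: friedrichs_space_def)
      have cont: "continuous_on \<Omega> F" using hol by (rule holomorphic_on_imp_continuous_on)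
      note intI = set_integrable_square_bound[OF op assms(2) _ int]
      define h where "h = Re (F x0)"
      have sq: "(Re w)\<^sup>2 \<le> (cmod w)\<^sup>2" "(Im w)\<^sup>2 \<le> (cmod w)\<^sup>2" for w by (simp_all add: cmod_power2)
      have intF: "set_integrable lborel \<Omega> F"
      proof (rule intI[of _ 1 1])
        show "norm (F z) \<le> 1 + 1 * (cmod (F z))\<^sup>2" for z
        proof -
          have "0 \<le> (cmod (F z) - 1)\<^sup>2" by simp
          hence "2 * cmod (F z) \<le> 1 + (cmod (F z))\<^sup>2" by (simp add: power2_eq_square algebra_simps)
          moreover have "0 \<le> cmod (F z)" by simp
          ultimately show ?thesis by linarith
        qed
      qed (rule cont)
      have intRe: "set_integrable lborel \<Omega> (\<lambda>z. Re (F z))"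
        using integrable_Re[OF intF[unfolded set_integrable_def]] by (simp add: set_integrable_def)
      have meanRe: "(LINT z:\<Omega>|lborel. Re (F z)) = 0"
        using integral_Re[OF intF[unfolded set_integrable_def]] mean by (simp add: set_lebesgue_integral_def)
      have intRe2: "set_integrable lborel \<Omega> (\<lambda>z. (Re (F z))\<^sup>2)" and intIm2: "set_integrable lborel \<Omega> (\<lambda>z. (Im (F z))\<^sup>2)"
        using sq cont by (auto intro!: intI[of _ 0 1] continuous_intros)
      have intRe2': "set_integrable lborel \<Omega> (\<lambda>z. (Re (F z) - h)\<^sup>2)"
      proof (rule intI[of _ "2 * h\<^sup>2" 2])
        show "norm ((Re (F z) - h)\<^sup>2) \<le> 2 * h\<^sup>2 + 2 * (cmod (F z))\<^sup>2" for z
        proof -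
          have "(Re (F z) - h)\<^sup>2 + (Re (F z) + h)\<^sup>2 = 2 * h\<^sup>2 + 2 * (Re (F z))\<^sup>2"
            by (simp add: power2_eq_square algebra_simps)
          moreover have "0 \<le> (Re (F z) + h)\<^sup>2" by simp
          ultimately have "(Re (F z) - h)\<^sup>2 \<le> 2 * h\<^sup>2 + 2 * (cmod (F z))\<^sup>2" using sq(1)[of "F z"] by linarith
          thus ?thesis by simp
        qed
      qed (intro continuous_intros cont)
      \<comment> \<open>The integrand on the right equals \<open>(Re (F z))^2 + h^2\<close>; its
        linear term then disappears because \<open>Re (F z)\<close> has mean zero.\<close>
      have "(LINT z:\<Omega>|lborel. (Re (F z))\<^sup>2) \<le> (LINT z:\<Omega>|lborel. (Re (F z) - h)\<^sup>2 + 2 * h * Re (F z))"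
        using intRe2 intRe2' intRe
        by (intro set_integral_mono set_integral_add(1) set_integrable_mult_right) (auto simp: power2_eq_square algebra_simps)
      also have "\<dots> = (LINT z:\<Omega>|lborel. (Re (F z) - h)\<^sup>2)"
        using intRe2' intRe meanRe by (subst set_integral_add(2)) auto
      also have "\<dots> \<le> C * (LINT z:\<Omega>|lborel. (Im (F z))\<^sup>2)"
      proof -
        have nn: "(\<integral>\<^sup>+z. ennreal (g z) * indicator \<Omega> z \<partial>lborel) = ennreal (LINT z:\<Omega>|lborel. g z)"
          if "set_integrable lborel \<Omega> g" "\<And>z. g z \<ge> 0" for g
        proof -
          have "(\<integral>\<^sup>+z. ennreal (g z) * indicator \<Omega> z \<partial>lborel) = (\<integral>\<^sup>+z. ennreal (indicator \<Omega> z *\<^sub>R g z) \<partial>lborel)"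
            by (intro nn_integral_cong) (auto simp: indicator_def)
          thus ?thesis using nn_integral_eq_integral[OF that(1)[unfolded set_integrable_def]] that(2)
            by (simp add: set_lebesgue_integral_def)
        qed
        \<comment> \<open>The real shift makes the real part vanish at \<open>x0\<close>, as the
          curve estimate requires, and leaves the imaginary part unchanged.\<close>
        have "(\<lambda>z. F z - of_real h) holomorphic_on \<Omega>" using hol by (intro holomorphic_intros)
        from nn_integral_Re_le_Im[OF this _ \<alpha> C] P
        have "ennreal (LINT z:\<Omega>|lborel. (Re (F z) - h)\<^sup>2) \<le> ennreal C * ennreal (LINT z:\<Omega>|lborel. (Im (F z))\<^sup>2)"
          using nn[OF intRe2'] nn[OF intIm2] by (simp add: h_def)
        moreover have "(LINT z:\<Omega>|lborel. (Im (F z))\<^sup>2) \<ge> 0"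
          unfolding set_lebesgue_integral_def by (intro Bochner_Integration.integral_nonneg) auto
        ultimately show ?thesis using C by (simp add: ennreal_mult''[symmetric])
      qed
      finally show ?thesis .
    qed
    thus ?thesis unfolding real friedrichs_constant_def using C by (intro Inf_lower) blast
  next
    case MInf
    obtain \<theta>0 where "(\<lambda>\<theta>. f \<theta> / m) differentiable at \<theta>0" using exists_differentiable by blast
    hence "ereal (HP_P (\<lambda>\<theta>. f \<theta> / m) \<alpha> \<theta>0) \<le> - \<infinity>" unfolding MInf[symmetric] by (intro SUP_upper) auto
    thus ?thesis by simp
  qed auto
  thus ?thesis unfolding HP_M_def norm Let_def by (intro INF_greatest) auto
qed

end
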